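(* Assume that either the fixed Hilbert space conditions or the moving Hilbert space conditions hold for $(\mathcal H,\mathbf a,\mathbf b,\mathbf c)$. Let $j\ge 1$ be an integer, and let $J_+\in\{0,1,2,\dots,\infty\}$ be the number of positive eigenvalues (counted with multiplicity) of $(\mathcal K,\mathbf a,\mathbf b)$. (i) If $j\le J_+$ (meaning $j<\infty$ when $J_+=\infty$), then $\lambda_j^t\nearrow\lambda_j(\mathcal K,\mathbf a,\mathbf b)$ as $t\nearrow\infty$. (ii) If $j>J_+$ and $\lambda_j^{t_*}$ exists for some $t_*\in\mathbb R$ (with $t_*$ sufficiently large, depending only on $\mathcal H,\mathbf a,\mathbf b,\mathbf c$, in the moving Hilbert space case), then there is $t_j\in(t_*,+\infty]$ such that $\lambda_j^t\nearrow+\infty$ as $t\nearrow t_j$.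
   Context: Let $(\mathcal H,\langle\cdot,\cdot\rangle)$ be a real Hilbert space with norm $\|\cdot\|$ and let $\mathbf a,\mathbf b,\mathbf c:\mathcal H\times\mathcal H\to\mathbb R$ be symmetric bilinear forms. Put $\mathbf b^t=\mathbf b-t\mathbf c$ for $t\in\mathbb R$, and $\mathbf A(u)=\mathbf a(u,u)$, $\mathbf B(u)=\mathbf b(u,u)$, $\mathbf C(u)=\mathbf c(u,u)$, $\mathbf B^t(u)=\mathbf b^t(u,u)$. Standing assumption: $\mathbf C\ge 0$ on $\mathcal H$ and $\mathbf C\not\equiv 0$. For a symmetric bilinear form $\mathbf f$ on $\mathcal H$, $\operatorname{Ker}(\mathbf f)=\{u\in\mathcal H:\mathbf f(u,v)=0\ \forall v\in\mathcal H\}$; put $\mathcal K=\operatorname{Ker}(\mathbf c)$. Conditions: (C1) there is $\gamma>0$ with $\gamma\|u\|^2\le\mathbf A(u)$ for all $u\in\mathcal H$. (C1$'$) $\dim\operatorname{Ker}(\mathbf a)<\infty$, $\mathbf A$ is coercive on $\operatorname{Ker}(\mathbf a)^\perp$ (i.e. $\gamma\|u\|^2\le\mathbf A(u)$ there for some $\gamma>0$; $\perp$ with respect to $\langle\cdot,\cdot\rangle$), and $\operatorname{Ker}(\mathbf a)\cap\mathcal K=\{0\}$. (C2) $\mathbf a$ is continuous on $\mathcal H\times\mathcal H$. (C3) $\mathbf b$ and $\mathbf c$ are weakly sequentially continuous: $u^n\rightharpoonup u$, $v^n\rightharpoonup v$ imply $\mathbf b(u^n,v^n)\to\mathbf b(u,v)$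 and $\mathbf c(u^n,v^n)\to\mathbf c(u,v)$. The fixed Hilbert space conditions are (C1),(C2),(C3); the moving Hilbert space conditions are (C1$'$),(C2),(C3). For a closed subspace $\mathcal V\subset\mathcal H$ and a symmetric form $\mathbf f$, an eigenvalue of $(\mathcal V,\mathbf a,\mathbf f)$ is $\lambda\in\mathbb R$ for which there is $u\in\mathcal V\setminus\{0\}$ (an eigenvector) with $\mathbf a(u,v)=\lambda\,\mathbf f(u,v)$ for all $v\in\mathcal V$. $\lambda_j(\mathcal V,\mathbf a,\mathbf f)$ and $\lambda_{-j}(\mathcal V,\mathbf a,\mathbf f)$ ($j\ge1$) denote the $j$-th positive eigenvalue in increasing order and the $j$-th negative eigenvalue in decreasing order, counted with multiplicity; such an eigenvalue "exists" if there are at least $j$ of that sign. Write $\lambda_{\pm j}^t=\lambda_{\pm j}(\mathcal H,\mathbf a,\mathbf b^t)$; in the moving case these are considered for $|t|$ sufficiently large. "$\lambda^t\nearrow\lambda$ as $t\nearrow t_\infty$" ($t_\infty\in(-\infty,\infty]$) means $\lambda^t\to\lambda$ and $\lambda^t$ is (weakly) increasing in $t$: for all $t$ for which it is considered in the fixed case, for all sufficiently large $t$ (depending only on $\mathcal H,\mathbf a,\mathbf b,\mathbf c$) in the moving case. In (ii) this includes that $\lambda_j^t$ exists for $t\in[t_*,t_j)$; in (i) that $\lambda_j^t$ exists for all $t$ (fixed case) or all sufficiently large $t$ (moving case). *)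

theory Defs
  imports "HOL-Analysis.Analysis"
begin

type_synonym 'a form = "'a \<Rightarrow> 'a \<Rightarrow> real"

definition sym_bilinear :: "'a::real_vector form \<Rightarrow> bool" where
  "sym_bilinear f \<longleftrightarrow> bilinear f \<and> (\<forall>u v. f u v = f v u)"

definition Ker :: "'a::real_vector form \<Rightarrow> 'a set" where
  "Ker f = {u. \<forall>v. f u v = 0}"

definition shifted_form :: "'a form \<Rightarrow> 'a form \<Rightarrow> real \<Rightarrow> 'a form" where
  "shifted_form b c t = (\<lambda>u v. b u v - t * c u v)"

text \<open>The library constant \<^const>\<open>dim\<close> is \<open>0\<close> on infinite-dimensional spaces.\<close>
definition edim :: "'a::real_vector set \<Rightarrow> enat" where
  "edim V = (if \<exists>B. finite B \<and> V \<subseteq> span B then enat (dim V) else \<infinity>)"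

definition weakly_converges :: "(nat \<Rightarrow> 'a::real_inner) \<Rightarrow> 'a \<Rightarrow> bool" where
  "weakly_converges x l \<longleftrightarrow> (\<forall>v. (\<lambda>n. inner (x n) v) \<longlonglongrightarrow> inner l v)"

definition weakly_seq_continuous :: "'a::real_inner form \<Rightarrow> bool" where
  "weakly_seq_continuous f \<longleftrightarrow>
     (\<forall>x y u v. weakly_converges x u \<longrightarrow> weakly_converges y v \<longrightarrow>
        (\<lambda>n. f (x n) (y n)) \<longlonglongrightarrow> f u v)"

definition coercive_on :: "'a::real_inner set \<Rightarrow> 'a form \<Rightarrow> bool" where
  "coercive_on V a \<longleftrightarrow> (\<exists>\<gamma>>0. \<forall>u\<in>V. \<gamma> * (norm u)\<^sup>2 \<le> a u u)"

definition jointly_continuous :: "'a::real_inner form \<Rightarrow> bool" where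
  "jointly_continuous a \<longleftrightarrow> continuous_on UNIV (\<lambda>(u, v). a u v)"

definition fixed_conditions :: "'a::real_inner form \<Rightarrow> 'a form \<Rightarrow> 'a form \<Rightarrow> bool" where
  "fixed_conditions a b c \<longleftrightarrow>
     coercive_on UNIV a \<and>
     jointly_continuous a \<and>
     weakly_seq_continuous b \<and> weakly_seq_continuous c"

definition moving_conditions :: "'a::real_inner form \<Rightarrow> 'a form \<Rightarrow> 'a form \<Rightarrow> bool" where
  "moving_conditions a b c \<longleftrightarrow>
     edim (Ker a) < \<infinity> \<and> coercive_on (orthogonal_comp (Ker a)) a \<and> Ker a \<inter> Ker c = {0} \<and>
     jointly_continuous a \<and>
     weakly_seq_continuous b \<and> weakly_seq_continuous c"

definition eigenspace :: "'a::real_vector set \<Rightarrow> 'a form \<Rightarrow> 'a form \<Rightarrow> real \<Rightarrow> 'a set" where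
  "eigenspace V a f \<mu> = {u \<in> V. \<forall>v\<in>V. a u v = \<mu> * f u v}"

definition is_eigenvalue :: "'a::real_vector set \<Rightarrow> 'a form \<Rightarrow> 'a form \<Rightarrow> real \<Rightarrow> bool" where
  "is_eigenvalue V a f \<mu> \<longleftrightarrow> (\<exists>u\<in>V - {0}. \<forall>v\<in>V. a u v = \<mu> * f u v)"

text \<open>The number of eigenvalues in \<open>S\<close>, counted with multiplicity: the sum of the multiplicities
  over all eigenvalues in \<open>S\<close>, written as the supremum of its finite partial sums.\<close>
definition eigencount :: "'a::real_vector set \<Rightarrow> 'a form \<Rightarrow> 'a form \<Rightarrow> real set \<Rightarrow> enat" where
  "eigencount V a f S =
     (SUP F\<in>{F. finite F \<and> F \<subseteq> {\<mu> \<in> S. is_eigenvalue V a f \<mu>}}. \<Sum>\<mu>\<in>F. edim (eigenspace V a f \<mu>))"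

definition num_pos_eigenvalues :: "'a::real_vector set \<Rightarrow> 'a form \<Rightarrow> 'a form \<Rightarrow> enat" where
  "num_pos_eigenvalues V a f = eigencount V a f {0<..}"

definition pos_eigenvalue_exists :: "'a::real_vector set \<Rightarrow> 'a form \<Rightarrow> 'a form \<Rightarrow> nat \<Rightarrow> bool" where
  "pos_eigenvalue_exists V a f j \<longleftrightarrow> enat j \<le> num_pos_eigenvalues V a f"

text \<open>The \<open>j\<close>-th positive eigenvalue (\<open>j \<ge> 1\<close>) in increasing order, counted with multiplicity: the
  least eigenvalue \<open>\<mu> > 0\<close> such that at least \<open>j\<close> positive eigenvalues are \<open>\<le> \<mu>\<close>.  The value is unspecified if
  there is no such \<open>\<mu>\<close>, in particular if there are fewer than \<open>j\<close> positive eigenvalues.\<close>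
definition pos_eigenvalue :: "'a::real_vector set \<Rightarrow> 'a form \<Rightarrow> 'a form \<Rightarrow> nat \<Rightarrow> real" where
  "pos_eigenvalue V a f j =
     (LEAST \<mu>. is_eigenvalue V a f \<mu> \<and> 0 < \<mu> \<and> enat j \<le> eigencount V a f {0<..\<mu>})"

text \<open>\<open>g(t) \<nearrow> L\<close> as \<open>t \<nearrow> s\<close>, where \<open>g\<close> is increasing on the set \<open>D\<close> of parameters under
  consideration and \<open>s\<close> may be \<open>\<infinity>\<close>.  As in the library's interval integrals, the one-sided limit is
  taken in the extended reals; for \<open>s = \<infinity>\<close> it is the limit along \<^term>\<open>at_top :: real filter\<close>.\<close>
definition increases_to :: "(real \<Rightarrow> real) \<Rightarrow> real set \<Rightarrow> ereal \<Rightarrow> ereal \<Rightarrow> bool" where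
  "increases_to g D s L \<longleftrightarrow>
     mono_on D g \<and> ((\<lambda>t. ereal (g (real_of_ereal t))) \<longlongrightarrow> L) (at_left s)"

end

theory Submission
  imports Defs "HOL-Library.Diagonal_Subsequence"
begin

text \<open>
  The basic observation is that \<open>\<lambda>\<^sub>j \<le> \<mu>\<close> holds, for \<open>\<mu> > 0\<close>, iff there is a \<open>j\<close>-dimensional subspace on which
  \<open>A \<le> \<mu> B\<^sup>t\<close>. Neither a lower bound \<open>A > 0\<close> nor a fixed Hilbert space is needed for this: it suffices that
  \<open>A \<ge> 0\<close> and that \<open>A - s B\<^sup>t\<close> is coercive for some \<open>s > 0\<close>, since replacing \<open>A\<close> by \<open>A - s B\<^sup>t\<close>
  shifts all eigenvalues by \<open>s\<close>. If \<open>A\<close> is coercive, every small \<open>s\<close> works; in the moving case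
  \<open>A + C\<close> is coercive, and \<open>s = 1/t\<close> works for large \<open>t\<close>.

  As \<open>B\<^sup>t\<close> decreases in \<open>t\<close>, monotonicity is immediate. If \<open>\<lambda>\<^sub>j\<^sup>t \<le> M\<close> for all \<open>t < t\<^sub>j\<close>, then
  orthonormal bases of the corresponding subspaces have weak limits, which again span a \<open>j\<close>-dimensional subspace with
  \<open>A \<le> M B\<^sup>t\<close> for all \<open>t < t\<^sub>j\<close>. If \<open>t\<^sub>j = \<infinity>\<close>, this forces \<open>C = 0\<close> on the subspace, so it lies
  in \<open>Ker c\<close> and shows \<open>\<lambda>\<^sub>j (Ker c) \<le> M\<close>. If \<open>t\<^sub>j < \<infinity>\<close>, then \<open>\<lambda>\<^sub>j\<^sup>t\<close> exists at \<open>t\<^sub>j\<close> and, existence being an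
  open condition, also beyond \<open>t\<^sub>j\<close>.
\<close>

section \<open>Weak sequential compactness\<close>

text \<open>The quadratic energy \<open>J\<close> is bounded below on \<open>Y\<close>; a minimising
  sequence is Cauchy by the parallelogram law, and its limit represents \<open>psi\<close>. As
  \<open>Y\<close> may fail to be closed, the limit is only placed in the closure.\<close>

lemma riesz_on_subspace:
  fixes psi :: "'a::{real_inner, complete_space} \<Rightarrow> real"
  assumes Y: "subspace Y"
    and add: "\<And>u v. u \<in> Y \<Longrightarrow> v \<in> Y \<Longrightarrow> psi (u + v) = psi u + psi v"
    and scale: "\<And>k u. u \<in> Y \<Longrightarrow> psi (k *\<^sub>R u) = k * psi u"
    and bound: "\<And>u. u \<in> Y \<Longrightarrow> \<bar>psi u\<bar> \<le> M * norm u"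
  obtains l where "l \<in> closure Y" and "\<And>v. v \<in> Y \<Longrightarrow> psi v = inner l v"
proof -
  define J where "J v = (norm v)\<^sup>2 - 2 * psi v" for v
  have J_lower: "- M\<^sup>2 \<le> J v" if "v \<in> Y" for v
  proof -
    have "0 \<le> (norm v - M)\<^sup>2" by simp
    then have "- M\<^sup>2 \<le> (norm v)\<^sup>2 - 2 * (M * norm v)" by (simp add: power2_diff algebra_simps)
    also have "\<dots> \<le> J v" using bound[OF that] by (simp add: J_def)
    finally show ?thesis .
  qed
  define m where "m = Inf (J ` Y)"
  have bdd: "bdd_below (J ` Y)" using J_lower by (auto intro!: bdd_belowI2)
  have m_le: "m \<le> J v" if "v \<in> Y" for v
    unfolding m_def using bdd that by (auto intro: cInf_lower)
  have "\<exists>v\<in>Y. J v < m + inverse (Suc n)" for n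
  proof -
    have "J ` Y \<noteq> {}" using subspace_0[OF Y] by auto
    moreover have "Inf (J ` Y) < m + inverse (Suc n)" by (simp add: m_def)
    ultimately have "\<exists>y\<in>J ` Y. y < m + inverse (Suc n)" by (rule cInf_lessD)
    then show ?thesis by (simp only: bex_simps)
  qed
  then obtain w where wY: "\<And>n. w n \<in> Y" and w_less: "\<And>n. J (w n) < m + inverse (Suc n)"
    by metis
  \<comment> \<open>The midpoint of \<open>u\<close> and \<open>v\<close> lies in \<open>Y\<close>,
    so its energy is at least \<open>m\<close>; this bounds their distance by how far each is from
    minimising.\<close>
  have parallelogram: "(norm (u - v))\<^sup>2 \<le> 2 * (J u - m) + 2 * (J v - m)" if "u \<in> Y" "v \<in> Y" for u v
  proof -
    define h where "h = (1/2) *\<^sub>R (u + v)"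
    have "h \<in> Y" unfolding h_def using that Y by (intro subspace_scale subspace_add)
    then have "m \<le> J h" by (rule m_le)
    moreover have "4 * (norm h)\<^sup>2 = (norm (u + v))\<^sup>2"
      unfolding h_def norm_scaleR power_mult_distrib by (simp add: power_divide)
    moreover have "psi h = (psi u + psi v) / 2"
      unfolding h_def using add[OF that] scale[OF subspace_add[OF Y that], of "1/2"] by simp
    moreover have "(norm (u - v))\<^sup>2 = 2 * (norm u)\<^sup>2 + 2 * (norm v)\<^sup>2 - (norm (u + v))\<^sup>2"
      by (simp add: power2_norm_eq_inner inner_simps inner_commute)
    ultimately show ?thesis unfolding J_def by argo
  qed
  have inv0: "(\<lambda>n. inverse (real (Suc n))) \<longlonglongrightarrow> 0" by (rule LIMSEQ_inverse_real_of_nat)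
  have "Cauchy w"
  proof (rule CauchyI)
    fix e :: real assume "e > 0"
    then have "\<forall>\<^sub>F n in sequentially. inverse (real (Suc n)) < e\<^sup>2 / 4"
      by (intro order_tendstoD[OF inv0]) simp
    then obtain N where N: "\<And>n. n \<ge> N \<Longrightarrow> inverse (real (Suc n)) < e\<^sup>2 / 4"
      by (auto simp: eventually_sequentially)
    have "norm (w i - w k) < e" if "i \<ge> N" "k \<ge> N" for i k
    proof -
      have "(norm (w i - w k))\<^sup>2 < e\<^sup>2"
        using parallelogram[OF wY wY, of i k] w_less[of i] w_less[of k] N[OF that(1)] N[OF that(2)]
        by argo
      then show ?thesis using \<open>e > 0\<close> by (simp add: power_less_imp_less_base)
    qed
    then show "\<exists>N. \<forall>i\<ge>N. \<forall>k\<ge>N. norm (w i - w k) < e" by blast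
  qed
  then obtain l where l: "w \<longlonglongrightarrow> l" using Cauchy_convergent convergentD by blast
  have "l \<in> closure Y" using l wY by (auto simp: closure_sequential)
  moreover have "psi v = inner l v" if v: "v \<in> Y" for v
  proof -
    define d where "d = inner l v - psi v"
    \<comment> \<open>First variation: compare \<open>J (w n)\<close> with
      \<open>J (w n + e *\<^sub>R v)\<close> and let \<open>n\<close> tend to infinity. A quadratic
      in \<open>e\<close> that is nonnegative everywhere and has no constant term has no linear term
      either, so \<open>d = 0\<close>.\<close>
    have var: "0 \<le> e\<^sup>2 * (norm v)\<^sup>2 + 2 * e * d" for e :: real
    proof -
      have "- inverse (real (Suc n)) \<le> e\<^sup>2 * (norm v)\<^sup>2 + 2 * e * (inner (w n) v - psi v)" for n
      proof -
        have "m \<le> J (w n + e *\<^sub>R v)" using wY v Y by (intro m_le subspace_add subspace_scale)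
        also have "\<dots> = J (w n) + e\<^sup>2 * (norm v)\<^sup>2 + 2 * e * (inner (w n) v - psi v)"
        proof -
          have "(norm (w n + e *\<^sub>R v))\<^sup>2 = (norm (w n))\<^sup>2 + 2 * e * inner (w n) v + e\<^sup>2 * (norm v)\<^sup>2"
            by (simp add: power2_norm_eq_inner inner_simps inner_commute power2_eq_square[of e] algebra_simps)
          then show ?thesis
            using add[OF wY subspace_scale[OF Y v], of n e] scale[OF v, of e]
            by (simp add: J_def algebra_simps)
        qed
        finally show ?thesis using w_less[of n] by linarith
      qed
      moreover have "(\<lambda>n. - inverse (real (Suc n))) \<longlonglongrightarrow> 0" using tendsto_minus[OF inv0] by simp
      moreover have "(\<lambda>n. e\<^sup>2 * (norm v)\<^sup>2 + 2 * e * (inner (w n) v - psi v))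
          \<longlonglongrightarrow> e\<^sup>2 * (norm v)\<^sup>2 + 2 * e * d"
        unfolding d_def by (intro tendsto_intros l)
      ultimately show ?thesis by (intro LIMSEQ_le[of _ 0]) auto
    qed
    have "d = 0"
    proof (cases "norm v = 0")
      case True then show ?thesis using var[of "- d"] by (simp add: power2_eq_square[symmetric])
    next
      case False
      then have "0 \<le> - d\<^sup>2 / (norm v)\<^sup>2"
        using var[of "- d / (norm v)\<^sup>2"] by (simp add: power2_eq_square field_simps)
      then show ?thesis using False
        by (metis divide_minus_left linorder_not_le neg_0_le_iff_le zero_less_power2 divide_pos_pos)
    qed
    then show ?thesis by (simp add: d_def)
  qed
  ultimately show thesis by (rule that)
qed

text \<open>Testing against the members of the sequence itself leaves countably many functionals for
  a diagonal argument. Riesz on their span yields the limit; boundedness extends the convergence to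
  the closure, and orthogonal projection to the whole space.\<close>

lemma weak_compactness:
  fixes x :: "nat \<Rightarrow> 'a::{real_inner, complete_space}"
  assumes bound: "\<And>n. norm (x n) \<le> M"
  obtains r l where "strict_mono r" and "weakly_converges (x \<circ> r) l"
proof -
  interpret subseqs "\<lambda>m r. convergent (\<lambda>n. inner (x (r n)) (x m))"
  proof
    fix m and s :: "nat \<Rightarrow> nat"
    have "\<bar>inner (x (s n)) (x m)\<bar> \<le> M * M" for n
      using Cauchy_Schwarz_ineq2[of "x (s n)" "x m"] bound[of "s n"] bound[of m] norm_ge_zero
      by (meson dual_order.trans mult_mono)
    then have "bounded (range (\<lambda>n. inner (x (s n)) (x m)))"
      by (auto simp: bounded_iff)
    then obtain l r where "strict_mono r" "((\<lambda>n. inner (x (s n)) (x m)) \<circ> r) \<longlonglongrightarrow> l"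
      using bounded_imp_convergent_subsequence by blast
    then show "\<exists>r. strict_mono r \<and> convergent (\<lambda>n. inner (x ((s \<circ> r) n)) (x m))"
      by (auto simp: o_def convergent_def)
  qed
  let ?z = "x \<circ> diagseq"
  have "convergent (\<lambda>n. inner (?z n) (x m))" for m
  proof -
    \<comment> \<open>Only the tail of \<open>diagseq\<close> from \<open>Suc m\<close> on is known
      to refine the sequence chosen for \<open>m\<close>; the initial segment does not affect
      convergence.\<close>
    have "convergent (\<lambda>n. inner (x ((diagseq \<circ> (+) (Suc m)) n)) (x m))"
    proof (rule diagseq_holds)
      fix r s :: "nat \<Rightarrow> nat" and n assume "strict_mono r" "convergent (\<lambda>k. inner (x (s k)) (x n))"
      then show "convergent (\<lambda>k. inner (x ((s \<circ> r) k)) (x n))"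
        using convergent_subseq_convergent[of "\<lambda>k. inner (x (s k)) (x n)" r] by (simp add: o_def)
    qed
    then have "convergent (\<lambda>n. inner (?z (n + Suc m)) (x m))" by (simp add: o_def add.commute)
    then show ?thesis by (rule convergent_ignore_initial_segment[THEN iffD1])
  qed
  define Y where "Y = span (range x)"
  have Y: "subspace Y" by (simp add: Y_def)
  have conv: "convergent (\<lambda>n. inner (?z n) v)" if "v \<in> Y" for v
    using that unfolding Y_def
  proof (induction rule: span_induct)
    case base
    show ?case
      by (auto intro!: subspaceI convergent_add convergent_const
          simp: inner_simps intro: convergent_mult)
  qed (use \<open>\<And>m. convergent (\<lambda>n. inner (?z n) (x m))\<close> in auto)
  define phi where "phi v = lim (\<lambda>n. inner (?z n) v)" for v
  have phi: "(\<lambda>n. inner (?z n) v) \<longlonglongrightarrow> phi v" if "v \<in> Y" for v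
    using conv[OF that] by (simp add: phi_def convergent_LIMSEQ_iff)
  have z_bound: "\<bar>inner (?z n) v\<bar> \<le> M * norm v" for n v
    using Cauchy_Schwarz_ineq2[of "?z n" v] bound[of "diagseq n"]
    by (simp add: mult_right_mono order_trans)
  obtain l where lY: "l \<in> closure Y" and l: "\<And>v. v \<in> Y \<Longrightarrow> phi v = inner l v"
  proof (rule riesz_on_subspace[OF Y, of phi M])
    fix u v assume uv: "u \<in> Y" "v \<in> Y"
    have "(\<lambda>n. inner (?z n) (u + v)) \<longlonglongrightarrow> phi u + phi v"
      unfolding inner_add_right by (intro tendsto_add phi uv)
    then show "phi (u + v) = phi u + phi v"
      using phi[OF subspace_add[OF Y uv]] LIMSEQ_unique by blast
  next
    fix k u assume u: "u \<in> Y"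
    have "(\<lambda>n. inner (?z n) (k *\<^sub>R u)) \<longlonglongrightarrow> k * phi u"
      unfolding inner_scaleR_right by (intro tendsto_mult_left phi u)
    then show "phi (k *\<^sub>R u) = k * phi u"
      using phi[OF subspace_scale[OF Y u]] LIMSEQ_unique by blast
  next
    fix u assume u: "u \<in> Y"
    show "\<bar>phi u\<bar> \<le> M * norm u"
      by (rule LIMSEQ_le_const2[OF tendsto_rabs[OF phi[OF u]]]) (use z_bound in auto)
  qed (use that in blast)
  have closureY: "(\<lambda>n. inner (?z n) p) \<longlonglongrightarrow> inner l p" if p: "p \<in> closure Y" for p
  proof (rule LIMSEQ_I)
    fix e :: real assume e: "e > 0"
    \<comment> \<open>Collects the factors of both approximation errors; the added 1 keeps it
      positive.\<close>
    define D where "D = \<bar>M\<bar> + norm l + 1"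
    have D: "D > 0" by (simp add: D_def add_nonneg_pos)
    obtain y where y: "y \<in> Y" "norm (y - p) < e / (2 * D)"
      using p e D unfolding closure_approachable dist_norm
      by (metis divide_pos_pos mult_pos_pos zero_less_numeral)
    have "(\<lambda>n. inner (?z n) y) \<longlonglongrightarrow> inner l y" using phi[OF y(1)] l[OF y(1)] by simp
    then obtain N where N: "\<And>n. n \<ge> N \<Longrightarrow> norm (inner (?z n) y - inner l y) < e / 2"
      using LIMSEQ_D[of _ "inner l y" "e / 2"] e by auto
    have "norm (inner (?z n) p - inner l p) < e" if "n \<ge> N" for n
    proof -
      have "\<bar>inner (?z n) (p - y)\<bar> + \<bar>inner l (y - p)\<bar> \<le> D * norm (y - p)"
      proof -
        have "\<bar>inner (?z n) (p - y)\<bar> \<le> \<bar>M\<bar> * norm (y - p)"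
          using z_bound[of n "p - y"] by (simp add: norm_minus_commute) (smt (verit) mult_right_mono norm_ge_zero)
        moreover have "\<bar>inner l (y - p)\<bar> \<le> norm l * norm (y - p)" by (rule Cauchy_Schwarz_ineq2)
        moreover have "D * norm (y - p) = \<bar>M\<bar> * norm (y - p) + norm l * norm (y - p) + norm (y - p)"
          by (simp add: D_def algebra_simps)
        ultimately show ?thesis using norm_ge_zero[of "y - p"] by linarith
      qed
      also have "\<dots> < e / 2" using y(2) D by (simp add: field_simps)
      finally have "\<bar>inner (?z n) (p - y)\<bar> + \<bar>inner l (y - p)\<bar> < e / 2" .
      moreover have "inner (?z n) p - inner l p
          = inner (?z n) (p - y) + (inner (?z n) y - inner l y) + inner l (y - p)"
        by (simp add: inner_simps)
      ultimately show ?thesis using N[OF that] unfolding real_norm_def by linarith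
    qed
    then show "\<exists>N. \<forall>n\<ge>N. norm (inner (?z n) p - inner l p) < e" by blast
  qed
  have "(\<lambda>n. inner (?z n) v) \<longlonglongrightarrow> inner l v" for v
  proof -
    \<comment> \<open>\<open>p\<close> is the orthogonal projection of \<open>v\<close> onto the
      closure of \<open>Y\<close>, found as the Riesz vector of \<open>inner v\<close> on
      \<open>Y\<close>.\<close>
    obtain p where pY: "p \<in> closure Y" and p: "\<And>y. y \<in> Y \<Longrightarrow> inner v y = inner p y"
      by (rule riesz_on_subspace[OF Y, of "inner v" "norm v"])
        (auto simp: inner_simps Cauchy_Schwarz_ineq2)
    have p': "inner y v = inner y p" if "y \<in> closure Y" for y
    proof -
      have "closed {y. inner y v = inner y p}"
        by (intro closed_Collect_eq continuous_intros)
      moreover have "Y \<subseteq> {y. inner y v = inner y p}" using p by (auto simp: inner_commute)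
      ultimately show ?thesis using that closure_minimal by blast
    qed
    have "?z n \<in> Y" for n by (simp add: Y_def span_base)
    then have "?z n \<in> closure Y" for n using closure_subset by blast
    then show ?thesis using closureY[OF pY] p'[OF lY] p' by simp
  qed
  then have "weakly_converges ?z l" by (simp add: weakly_converges_def)
  then show thesis by (rule that[OF subseq_diagseq])
qed

section \<open>Symmetric bilinear forms\<close>

lemma weakly_converges_const: "weakly_converges (\<lambda>_. v) v"
  by (simp add: weakly_converges_def)

lemma weakly_converges_subseq:
  "weakly_converges x l \<Longrightarrow> strict_mono r \<Longrightarrow> weakly_converges (x \<circ> r) l"
  by (auto simp: weakly_converges_def o_def intro: LIMSEQ_subseq_LIMSEQ[unfolded o_def])

lemma weakly_converges_scaleR_sum:
  assumes "\<And>i. i \<in> S \<Longrightarrow> weakly_converges (\<lambda>n. e n i) (l i)"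
  shows "weakly_converges (\<lambda>n. \<Sum>i\<in>S. x i *\<^sub>R e n i) (\<Sum>i\<in>S. x i *\<^sub>R l i)"
  using assms unfolding weakly_converges_def inner_sum_left inner_scaleR_left
  by (intro allI tendsto_sum tendsto_mult_left) auto

lemma sym_bilinear_commute: "sym_bilinear f \<Longrightarrow> f u v = f v u"
  by (simp add: sym_bilinear_def)

lemma sym_bilinear_bilinear: "sym_bilinear f \<Longrightarrow> bilinear f"
  by (simp add: sym_bilinear_def)

lemmas sym_bilinear_simps =
  bilinear_ladd[OF sym_bilinear_bilinear] bilinear_radd[OF sym_bilinear_bilinear]
  bilinear_lsub[OF sym_bilinear_bilinear] bilinear_rsub[OF sym_bilinear_bilinear]
  bilinear_lmul[OF sym_bilinear_bilinear] bilinear_rmul[OF sym_bilinear_bilinear]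
  bilinear_lzero[OF sym_bilinear_bilinear] bilinear_rzero[OF sym_bilinear_bilinear]

lemma sym_bilinear_shifted_form:
  assumes "sym_bilinear b" "sym_bilinear c"
  shows "sym_bilinear (shifted_form b c t)"
  using assms unfolding sym_bilinear_def bilinear_def shifted_form_def linear_iff
  by (auto simp: algebra_simps)

lemma weakly_seq_continuous_shifted_form:
  assumes "weakly_seq_continuous b" "weakly_seq_continuous c"
  shows "weakly_seq_continuous (shifted_form b c t)"
  using assms unfolding weakly_seq_continuous_def shifted_form_def
  by (auto intro!: tendsto_diff tendsto_mult_left)

lemma sym_bilinear_square_add:
  assumes "sym_bilinear f"
  shows "f (u + v) (u + v) = f u u + 2 * f u v + f v v"
  using sym_bilinear_commute[OF assms, of v u] by (simp add: sym_bilinear_simps[OF assms])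

lemma sym_bilinear_square_diff:
  assumes "sym_bilinear f"
  shows "f (u - v) (u - v) = f u u - 2 * f u v + f v v"
  using sym_bilinear_commute[OF assms, of v u] by (simp add: sym_bilinear_simps[OF assms])

lemma sym_bilinear_square_scale:
  assumes "sym_bilinear f"
  shows "f (k *\<^sub>R u) (k *\<^sub>R u) = k\<^sup>2 * f u u"
  by (simp add: sym_bilinear_simps[OF assms] power2_eq_square)

text \<open>The degenerate case of Cauchy-Schwarz: moving from \<open>v\<close> along
  \<open>w\<close>, against the sign of \<open>q v w\<close>, would make \<open>q\<close> negative.
  The 1 in \<open>r\<close> keeps the step length defined when \<open>q w w = 0\<close>.\<close>

lemma semidefinite_null_vector:
  assumes q: "sym_bilinear q" and W: "subspace W"
    and nonneg: "\<And>u. u \<in> W \<Longrightarrow> 0 \<le> q u u"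
    and v: "v \<in> W" "q v v = 0" and w: "w \<in> W"
  shows "q v w = 0"
proof (rule ccontr)
  assume ne: "q v w \<noteq> 0"
  define r where "r = q w w + 1"
  have r: "r > 0" using nonneg[OF w] by (simp add: r_def)
  define k where "k = - q v w / r"
  have "0 \<le> q (v + k *\<^sub>R w) (v + k *\<^sub>R w)"
    using v w W by (intro nonneg subspace_add subspace_scale)
  also have "\<dots> = 2 * k * q v w + k\<^sup>2 * (r - 1)"
    unfolding sym_bilinear_square_add[OF q] sym_bilinear_square_scale[OF q]
    by (simp add: v(2) sym_bilinear_simps[OF q] r_def)
  also have "\<dots> = - (q v w)\<^sup>2 * (r + 1) / r\<^sup>2"
    using r by (simp add: k_def field_simps power2_eq_square)
  also have "\<dots> < 0" using ne r by (simp add: divide_neg_pos mult_neg_pos)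
  finally show False by simp
qed

text \<open>Otherwise \<open>f\<close> would be unbounded along every subsequence of certain unit
  vectors, while it converges along a weakly convergent one.\<close>

lemma weakly_seq_continuous_bounded:
  fixes f :: "'a::{real_inner, complete_space} \<Rightarrow> 'a \<Rightarrow> real"
  assumes f: "sym_bilinear f" "weakly_seq_continuous f"
  shows "\<exists>\<beta>>0. \<forall>u. \<bar>f u u\<bar> \<le> \<beta> * (norm u)\<^sup>2"
proof (rule ccontr)
  assume "\<not> ?thesis"
  then have "\<exists>u. real (Suc n) * (norm u)\<^sup>2 < \<bar>f u u\<bar>" for n
    by (metis linorder_not_le of_nat_0_less_iff zero_less_Suc)
  then obtain u where u: "\<And>n. real (Suc n) * (norm (u n))\<^sup>2 < \<bar>f (u n) (u n)\<bar>" by metis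
  have u0: "u n \<noteq> 0" for n using u[of n] by (auto simp: sym_bilinear_simps[OF f(1)])
  define v where "v n = (1 / norm (u n)) *\<^sub>R u n" for n
  have "norm (v n) \<le> 1" for n using u0[of n] by (simp add: v_def)
  then obtain r l where r: "strict_mono r" and l: "weakly_converges (v \<circ> r) l"
    using weak_compactness by metis
  have v_large: "real n < \<bar>f (v n) (v n)\<bar>" for n
  proof -
    have "real n < real (Suc n)" by simp
    also have "\<dots> < \<bar>f (u n) (u n)\<bar> / (norm (u n))\<^sup>2"
      using u[of n] u0[of n] by (simp add: pos_less_divide_eq)
    also have "\<dots> = \<bar>f (v n) (v n)\<bar>"
      unfolding v_def sym_bilinear_square_scale[OF f(1)] by (simp add: abs_mult power_divide)
    finally show ?thesis .
  qed
  have "(\<lambda>n. f ((v \<circ> r) n) ((v \<circ> r) n)) \<longlonglongrightarrow> f l l"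
    using f(2) l unfolding weakly_seq_continuous_def by blast
  then have "Bseq (\<lambda>n. f ((v \<circ> r) n) ((v \<circ> r) n))" by (intro convergent_imp_Bseq convergentI)
  then obtain C where C: "\<And>n. \<bar>f (v (r n)) (v (r n))\<bar> \<le> C" by (auto simp: Bseq_def)
  obtain n where n: "C < real n" using reals_Archimedean2 by blast
  have "real n \<le> real (r n)" using seq_suble[OF r, of n] by simp
  then show False using n v_large[of "r n"] C[of n] by linarith
qed

lemma jointly_continuous_bounded:
  fixes a :: "'a::real_inner \<Rightarrow> 'a \<Rightarrow> real"
  assumes a: "sym_bilinear a" and cont: "jointly_continuous a"
  shows "\<exists>\<alpha>>0. \<forall>u v. \<bar>a u v\<bar> \<le> \<alpha> * norm u * norm v"
proof -
  have "\<exists>d>0. \<forall>p\<in>UNIV. dist p (0, 0) < d \<longrightarrow> dist (case p of (u, v) \<Rightarrow> a u v) (case (0, 0) of (u, v) \<Rightarrow> a u v) < 1"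
    using cont unfolding jointly_continuous_def continuous_on_iff by (metis UNIV_I zero_less_one)
  then obtain d where d: "d > 0" and small: "\<And>u v. norm (u, v) < d \<Longrightarrow> \<bar>a u v\<bar> < 1"
    by (auto simp: dist_norm sym_bilinear_simps[OF a])
  have "\<bar>a u v\<bar> \<le> (4 / d\<^sup>2) * norm u * norm v" for u v
  proof (cases "u = 0 \<or> v = 0")
    case True then show ?thesis by (auto simp: sym_bilinear_simps[OF a])
  next
    case False
    \<comment> \<open>Both vectors are scaled to norm \<open>d / 2\<close>, so that the pair has
      norm \<open>d / sqrt 2\<close>, inside the ball where \<open>a\<close> is small; homogeneity
      transfers the bound back.\<close>
    define x where "x = (d / (2 * norm u)) *\<^sub>R u"
    define y where "y = (d / (2 * norm v)) *\<^sub>R v"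
    have "norm x = d / 2" "norm y = d / 2" using False d by (auto simp: x_def y_def)
    then have "norm (x, y) = sqrt ((d / 2)\<^sup>2 + (d / 2)\<^sup>2)" by (simp only: norm_Pair)
    also have "\<dots> = sqrt (d\<^sup>2 / 2)" by (simp add: power_divide)
    also have "\<dots> < sqrt (d\<^sup>2)" by (rule real_sqrt_less_mono) (use d in simp)
    also have "\<dots> = d" using d by simp
    finally have "\<bar>a x y\<bar> < 1" by (rule small)
    moreover have "a x y = d\<^sup>2 / (4 * norm u * norm v) * a u v"
      by (simp add: x_def y_def sym_bilinear_simps[OF a] power2_eq_square mult_ac)
    ultimately have "d\<^sup>2 / (4 * norm u * norm v) * \<bar>a u v\<bar> \<le> 1"
      by (simp add: abs_mult)
    then show ?thesis using False d by (simp add: field_simps)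
  qed
  then show ?thesis using d by (intro exI[of _ "4 / d\<^sup>2"]) simp
qed

text \<open>Expanding \<open>0 \<le> a (x n - l) (x n - l)\<close> bounds
  \<open>a (x n) (x n)\<close> below by an affine expression in \<open>x n\<close>, and
  \<open>a l\<close> is weakly continuous by Riesz. The bound \<open>g n\<close> varies with
  \<open>n\<close> so that weakly continuous terms may serve as bounds.\<close>

lemma weak_lower_semicontinuity:
  fixes a :: "'a::{real_inner, complete_space} \<Rightarrow> 'a \<Rightarrow> real"
  assumes a: "sym_bilinear a" "jointly_continuous a" and nonneg: "\<And>u. 0 \<le> a u u"
    and x: "weakly_converges x l" and le: "\<forall>\<^sub>F n in sequentially. a (x n) (x n) \<le> g n"
    and g: "g \<longlonglongrightarrow> L"
  shows "a l l \<le> L"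
proof -
  obtain \<alpha> where "\<alpha> > 0" and \<alpha>: "\<And>u v. \<bar>a u v\<bar> \<le> \<alpha> * norm u * norm v"
    using jointly_continuous_bounded[OF a] by blast
  obtain z where z: "\<And>v. v \<in> UNIV \<Longrightarrow> a l v = inner z v"
    by (rule riesz_on_subspace[of UNIV "a l" "\<alpha> * norm l"])
      (use \<alpha> in \<open>auto simp: sym_bilinear_simps[OF a(1)]\<close>)
  have "(\<lambda>n. inner (x n) z) \<longlonglongrightarrow> inner l z"
    using x by (simp add: weakly_converges_def)
  then have "(\<lambda>n. a l (x n)) \<longlonglongrightarrow> a l l" by (simp add: z inner_commute)
  then have "(\<lambda>n. 2 * a l (x n) - a l l) \<longlonglongrightarrow> 2 * a l l - a l l" by (intro tendsto_intros)
  moreover have "\<forall>\<^sub>F n in sequentially. 2 * a l (x n) - a l l \<le> g n"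
    using le
  proof eventually_elim
    case (elim n)
    have "0 \<le> a (x n - l) (x n - l)" by (rule nonneg)
    then show ?case using elim sym_bilinear_commute[OF a(1), of l "x n"]
      by (simp add: sym_bilinear_square_diff[OF a(1)])
  qed
  ultimately show ?thesis using tendsto_le[OF _ g] by fastforce
qed

section \<open>Independent sets and extended dimension\<close>

lemma independent_Un:
  fixes S T :: "'a::real_vector set"
  assumes S: "independent S" and "finite T" "independent T" "span S \<inter> span T \<subseteq> {0}"
  shows "independent (S \<union> T)"
  using assms(2-)
proof (induction T)
  case empty
  then show ?case using S by simp
next
  case (insert t T)
  have T: "independent T" "t \<notin> span T"
    using insert.prems(1) insert.hyps by (auto simp: independent_insert)
  have sub: "span T \<subseteq> span (insert t T)" by (rule span_mono) auto
  have "t \<notin> span (S \<union> T)"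
  proof
    assume "t \<in> span (S \<union> T)"
    then obtain x y where xy: "t = x + y" "x \<in> span S" "y \<in> span T" by (auto simp: span_Un)
    have "x = t - y" using xy by simp
    moreover have "t \<in> span (insert t T)" by (simp add: span_base)
    ultimately have "x \<in> span (insert t T)" using xy(3) sub by (auto intro: span_diff)
    then have "x = 0" using insert.prems(2) xy(2) by auto
    then show False using xy T by simp
  qed
  moreover have "independent (S \<union> T)" using insert.IH T(1) insert.prems(2) sub by blast
  ultimately show ?case by (simp add: independent_insertI)
qed

lemma edim_basis:
  assumes "edim V \<noteq> \<infinity>"
  obtains B where "B \<subseteq> V" "independent B" "finite B" "V \<subseteq> span B" "edim V = enat (card B)"
proof -
  obtain C where C: "finite C" "V \<subseteq> span C" using assms by (auto simp: edim_def split: if_splits)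
  obtain B where B: "B \<subseteq> V" "independent B" "V \<subseteq> span B" "card B = dim V"
    by (rule basis_exists[of V])
  have "finite B" using independent_span_bound[OF C(1) B(2)] B(1) C(2) by blast
  moreover have "edim V = enat (card B)" using C B(4) by (auto simp: edim_def)
  ultimately show thesis using that B by blast
qed

lemma edim_infinite:
  assumes "edim V = \<infinity>"
  obtains B where "B \<subseteq> V" "independent B" "finite B" "card B = k"
proof -
  obtain C where C: "C \<subseteq> V" "independent C" "V \<subseteq> span C" "card C = dim V"
    by (rule basis_exists[of V])
  have "infinite C" using assms C(3) by (auto simp: edim_def split: if_splits)
  then obtain B where B: "finite B" "card B = k" "B \<subseteq> C"
    using infinite_arbitrarily_large by blast
  show thesis by (rule that[of B]) (use B C independent_mono[of C B] in auto)
qed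

section \<open>Variational characterization of the positive eigenvalues\<close>

text \<open>The condition of the min-max principle. The test space is given by a basis, which fixes
  its dimension as exactly \<open>j\<close>.\<close>

definition dominated :: "'a::real_vector set \<Rightarrow> 'a form \<Rightarrow> 'a form \<Rightarrow> real \<Rightarrow> nat \<Rightarrow> bool" where
  "dominated W a f \<mu> j \<longleftrightarrow>
     (\<exists>B. independent B \<and> finite B \<and> card B = j \<and> (\<forall>u\<in>span B. u \<in> W \<and> a u u \<le> \<mu> * f u u))"

text \<open>Serves two instances: \<open>W = UNIV\<close> with the shifted form, and
  \<open>W = Ker c\<close> with \<open>b\<close>. Closedness is phrased by weak sequences because
  the limits taken in \<open>W\<close> are weak ones.\<close>

locale spectral_pair =
  fixes W :: "'a::{real_inner, complete_space} set" and a f :: "'a \<Rightarrow> 'a \<Rightarrow> real"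
  assumes W: "subspace W"
    and W_closed: "\<And>x l. (\<And>n. x n \<in> W) \<Longrightarrow> weakly_converges x l \<Longrightarrow> l \<in> W"
    and a: "sym_bilinear a" and a_cont: "jointly_continuous a" and a_nonneg: "\<And>u. 0 \<le> a u u"
    and f: "sym_bilinear f" and f_cont: "weakly_seq_continuous f"
    and coercive: "\<exists>s>0. coercive_on W (shifted_form a f s)"
begin

lemmas simps = sym_bilinear_simps[OF a] sym_bilinear_simps[OF f]

lemma f_limit: "weakly_converges x u \<Longrightarrow> weakly_converges y v \<Longrightarrow> (\<lambda>n. f (x n) (y n)) \<longlonglongrightarrow> f u v"
  using f_cont unfolding weakly_seq_continuous_def by blast

lemma coercive': "\<exists>s>0. \<exists>\<eta>>0. \<forall>u\<in>W. \<eta> * (norm u)\<^sup>2 \<le> a u u - s * f u u"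
  using coercive by (simp add: coercive_on_def shifted_form_def)

text \<open>If \<open>f u u\<close> were not positive, \<open>a_nonneg\<close> would force
  \<open>a u u\<close> and \<open>f u u\<close> both to vanish, against coercivity. Hence
  \<open>f\<close> is positive definite on every test space.\<close>

lemma f_pos:
  assumes u: "u \<in> W" "u \<noteq> 0" and "\<mu> > 0" and le: "a u u \<le> \<mu> * f u u"
  shows "f u u > 0"
proof (rule ccontr)
  assume "\<not> f u u > 0"
  then have "\<mu> * f u u \<le> 0" using \<open>\<mu> > 0\<close> by (simp add: mult_nonneg_nonpos)
  then have "a u u = 0" "\<mu> * f u u = 0" using a_nonneg[of u] le by linarith+
  then have *: "a u u = 0" "f u u = 0" using \<open>\<mu> > 0\<close> by simp_all
  obtain s \<eta> where "\<eta> > 0" and "\<eta> * (norm u)\<^sup>2 \<le> a u u - s * f u u"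
    using coercive' u(1) by blast
  then have "\<eta> * (norm u)\<^sup>2 \<le> 0" using * by simp
  then show False using \<open>\<eta> > 0\<close> u(2) by (simp add: mult_le_0_iff)
qed

section \<open>Eigenspaces and their \<open>f\<close>-orthogonality\<close>

lemma eigenspaceD:
  assumes "u \<in> eigenspace W a f \<mu>"
  shows "u \<in> W" and "v \<in> W \<Longrightarrow> a u v = \<mu> * f u v"
  using assms by (auto simp: eigenspace_def)

lemma eigenspace_orthogonal:
  assumes "u \<in> eigenspace W a f \<mu>" "v \<in> eigenspace W a f \<nu>" "\<mu> \<noteq> \<nu>"
  shows "f u v = 0"
proof -
  have "a u v = \<mu> * f u v" "a v u = \<nu> * f v u" using assms by (auto simp: eigenspace_def)
  then have "\<mu> * f u v = \<nu> * f u v"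
    using sym_bilinear_commute[OF a, of u v] sym_bilinear_commute[OF f, of u v] by metis
  then show ?thesis using assms(3) by simp
qed

lemma subspace_eigenspace: "subspace (eigenspace W a f \<mu>)"
  using W by (intro subspaceI) (auto simp: eigenspace_def simps subspace_0 subspace_add subspace_scale algebra_simps)

lemma eigenvector_f_pos:
  assumes "u \<in> eigenspace W a f \<mu>" "u \<noteq> 0" "\<mu> > 0"
  shows "f u u > 0"
  using f_pos[of u \<mu>] eigenspaceD[OF assms(1)] assms by auto

lemma is_eigenvalue_iff: "is_eigenvalue W a f \<mu> \<longleftrightarrow> (\<exists>u\<in>eigenspace W a f \<mu>. u \<noteq> 0)"
  by (auto simp: is_eigenvalue_def eigenspace_def)

text \<open>Distinct eigenspaces are orthogonal for \<open>f\<close>, hence for \<open>a\<close>,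
  and \<open>f\<close> is positive definite on those of positive eigenvalues; so their sum is direct
  and the inequalities add up. The last conjunct carries the orthogonality through the
  induction.\<close>

lemma eigenbasis_union:
  assumes "finite F" and "F \<subseteq> {0<..\<mu>}"
    and "\<And>\<nu>. \<nu> \<in> F \<Longrightarrow> B \<nu> \<subseteq> eigenspace W a f \<nu> \<and> independent (B \<nu>) \<and> finite (B \<nu>)"
  shows "independent (\<Union>(B ` F)) \<and> card (\<Union>(B ` F)) = (\<Sum>\<nu>\<in>F. card (B \<nu>)) \<and>
    (\<forall>u\<in>span (\<Union>(B ` F)). u \<in> W \<and> a u u \<le> \<mu> * f u u \<and>
      (\<forall>\<nu>. \<nu> \<notin> F \<longrightarrow> (\<forall>v\<in>eigenspace W a f \<nu>. f u v = 0)))"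
  using assms
proof (induction F)
  case empty
  then show ?case using W by (auto simp: simps subspace_0 independent_empty)
next
  case (insert \<nu> F)
  let ?U = "\<Union>(B ` F)"
  have IH: "independent ?U" "card ?U = (\<Sum>\<nu>\<in>F. card (B \<nu>))"
    and IH_span: "\<And>u. u \<in> span ?U \<Longrightarrow> u \<in> W \<and> a u u \<le> \<mu> * f u u"
    and IH_orth: "\<And>u \<kappa> v. u \<in> span ?U \<Longrightarrow> \<kappa> \<notin> F \<Longrightarrow> v \<in> eigenspace W a f \<kappa> \<Longrightarrow> f u v = 0"
    using insert.IH insert.prems by auto
  have \<nu>: "0 < \<nu>" "\<nu> \<le> \<mu>" and B\<nu>: "B \<nu> \<subseteq> eigenspace W a f \<nu>" "independent (B \<nu>)" "finite (B \<nu>)"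
    using insert.prems by auto
  have span_B: "span (B \<nu>) \<subseteq> eigenspace W a f \<nu>"
    using span_minimal[OF B\<nu>(1) subspace_eigenspace] .
  have finU: "finite ?U" using insert.prems(2) insert.hyps(1) by auto
  have Int: "span ?U \<inter> span (B \<nu>) \<subseteq> {0}"
  proof safe
    fix u assume u: "u \<in> span ?U" "u \<in> span (B \<nu>)"
    then have "f u u = 0" using IH_orth insert.hyps(2) span_B by blast
    then show "u = 0" using eigenvector_f_pos[of u \<nu>] u(2) span_B \<nu>(1) by force
  qed
  have "independent (?U \<union> B \<nu>)" using independent_Un[OF IH(1) B\<nu>(3,2) Int] .
  moreover have "card (?U \<union> B \<nu>) = card ?U + card (B \<nu>)"
  proof (rule card_Un_disjoint[OF finU B\<nu>(3)])
    have "0 \<notin> B \<nu>" using B\<nu>(2) dependent_zero by blast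
    then show "?U \<inter> B \<nu> = {}" using Int span_base by blast
  qed
  moreover have "u \<in> W \<and> a u u \<le> \<mu> * f u u \<and>
      (\<forall>\<kappa>. \<kappa> \<notin> insert \<nu> F \<longrightarrow> (\<forall>v\<in>eigenspace W a f \<kappa>. f u v = 0))" if u_span: "u \<in> span (?U \<union> B \<nu>)" for u
  proof -
    obtain x y where u: "u = x + y" and x: "x \<in> span ?U" and y: "y \<in> eigenspace W a f \<nu>"
      using u_span span_B unfolding span_Un by blast
    have xW: "x \<in> W" and yW: "y \<in> W" using IH_span[OF x] eigenspaceD(1)[OF y] by auto
    have fxy: "f x y = 0" using IH_orth[OF x insert.hyps(2) y] .
    then have axy: "a x y = 0"
      using eigenspaceD(2)[OF y xW] sym_bilinear_commute[OF a, of x y] sym_bilinear_commute[OF f, of x y]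
      by simp
    have ayy: "a y y = \<nu> * f y y" using eigenspaceD(2)[OF y yW] .
    then have "0 \<le> f y y" using a_nonneg[of y] \<nu>(1) by (simp add: zero_le_mult_iff)
    then have "a y y \<le> \<mu> * f y y" unfolding ayy using \<nu>(2) by (simp add: mult_right_mono)
    then have "a u u \<le> \<mu> * f u u"
      using IH_span[OF x] axy fxy
      by (simp add: u sym_bilinear_square_add[OF a] sym_bilinear_square_add[OF f] distrib_left)
    moreover have "f u v = 0" if "\<kappa> \<notin> insert \<nu> F" "v \<in> eigenspace W a f \<kappa>" for \<kappa> v
      using IH_orth[OF x _ that(2)] eigenspace_orthogonal[OF y that(2)] that(1) by (auto simp: u simps)
    moreover have "u \<in> W" using xW yW W by (simp add: u subspace_add)
    ultimately show ?thesis by blast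
  qed
  moreover have "\<Union>(B ` insert \<nu> F) = ?U \<union> B \<nu>" by auto
  ultimately show ?case using IH(2) insert.hyps by (simp add: add.commute)
qed

text \<open>Writing \<open>j = Suc i\<close> turns the lower bound on a supremum into a strict one
  by \<open>enat i\<close>, which some finite partial sum already satisfies; strictness excludes the
  empty sum.\<close>

lemma eigencount_ge_witness:
  assumes "1 \<le> j" "enat j \<le> eigencount W a f S"
  obtains F where "finite F" "F \<subseteq> S" "F \<noteq> {}" "\<forall>\<mu>\<in>F. is_eigenvalue W a f \<mu>"
    "enat j \<le> (\<Sum>\<mu>\<in>F. edim (eigenspace W a f \<mu>))"
proof -
  obtain i where j: "j = Suc i" using assms(1) by (cases j) auto
  have "enat i < eigencount W a f S" using assms(2) by (simp add: j Suc_ile_eq)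
  then obtain F where F: "finite F" "F \<subseteq> {\<mu> \<in> S. is_eigenvalue W a f \<mu>}"
    "enat i < (\<Sum>\<mu>\<in>F. edim (eigenspace W a f \<mu>))"
    unfolding eigencount_def less_SUP_iff by auto
  moreover have "F \<noteq> {}" using F(3) by auto
  ultimately show thesis by (intro that[of F]) (auto simp: j Suc_ile_eq)
qed

lemma eigencount_ge:
  assumes "finite F" "F \<subseteq> S" "\<forall>\<mu>\<in>F. is_eigenvalue W a f \<mu>"
  shows "(\<Sum>\<mu>\<in>F. edim (eigenspace W a f \<mu>)) \<le> eigencount W a f S"
  unfolding eigencount_def using assms by (intro SUP_upper) auto

lemma sum_edim_enat:
  assumes "finite F" "\<And>\<mu>. \<mu> \<in> F \<Longrightarrow> edim (E \<mu>) = enat (n \<mu>)"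
  shows "(\<Sum>\<mu>\<in>F. edim (E \<mu>)) = enat (\<Sum>\<mu>\<in>F. n \<mu>)"
  using assms by (induction F) (auto simp: zero_enat_def)

lemma dominated_of_eigencount:
  assumes j: "1 \<le> j" "enat j \<le> eigencount W a f {0<..\<mu>}"
  shows "dominated W a f \<mu> j"
proof -
  obtain F where F: "finite F" "F \<subseteq> {0<..\<mu>}"
    "enat j \<le> (\<Sum>\<nu>\<in>F. edim (eigenspace W a f \<nu>))"
    using eigencount_ge_witness[OF j] by metis
  let ?E = "eigenspace W a f"
  \<comment> \<open>Infinite multiplicity is not excluded at this point; then \<open>j\<close>
    independent eigenvectors of that single eigenvalue are enough.\<close>
  have "\<exists>B. B \<subseteq> ?E \<nu> \<and> independent B \<and> finite B \<and>
      (if edim (?E \<nu>) = \<infinity> then card B = j else edim (?E \<nu>) = enat (card B))" for \<nu>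
  proof (cases "edim (?E \<nu>) = \<infinity>")
    case True
    then obtain B where "B \<subseteq> ?E \<nu>" "independent B" "finite B" "card B = j" by (rule edim_infinite)
    then show ?thesis using True by auto
  next
    case False
    then obtain B where "B \<subseteq> ?E \<nu>" "independent B" "finite B" "?E \<nu> \<subseteq> span B" "edim (?E \<nu>) = enat (card B)"
      by (rule edim_basis)
    then show ?thesis using False by auto
  qed
  then obtain B where B: "\<And>\<nu>. B \<nu> \<subseteq> ?E \<nu> \<and> independent (B \<nu>) \<and> finite (B \<nu>)"
    and card_B: "\<And>\<nu>. if edim (?E \<nu>) = \<infinity> then card (B \<nu>) = j else edim (?E \<nu>) = enat (card (B \<nu>))"
    by metis
  let ?U = "\<Union>(B ` F)"
  have U: "independent ?U" "card ?U = (\<Sum>\<nu>\<in>F. card (B \<nu>))"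
    and U_span: "\<And>u. u \<in> span ?U \<Longrightarrow> u \<in> W \<and> a u u \<le> \<mu> * f u u"
    using eigenbasis_union[OF F(1,2), of B] B by auto
  have "j \<le> card ?U"
  proof (cases "\<exists>\<nu>\<in>F. edim (?E \<nu>) = \<infinity>")
    case True
    then obtain \<nu> where \<nu>: "\<nu> \<in> F" "card (B \<nu>) = j" using card_B by metis
    then show ?thesis unfolding U(2) using member_le_sum[OF \<nu>(1), of "\<lambda>\<nu>. card (B \<nu>)"] F(1) by auto
  next
    case False
    then have "(\<Sum>\<nu>\<in>F. edim (?E \<nu>)) = enat (\<Sum>\<nu>\<in>F. card (B \<nu>))"
      using card_B F(1) by (intro sum_edim_enat) metis+
    then show ?thesis using F(3) U(2) by simp
  qed
  then obtain V where V: "V \<subseteq> ?U" "card V = j" "finite V" by (rule obtain_subset_with_card_n)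
  have "independent V" using U(1) V(1) independent_mono by blast
  moreover have "span V \<subseteq> span ?U" using V(1) by (rule span_mono)
  ultimately show ?thesis unfolding dominated_def using V U_span by blast
qed

text \<open>Infinitely many distinct eigenvalues would give \<open>f\<close>-orthogonal unit
  eigenvectors. Coercivity keeps \<open>\<mu> * f\<close> at least \<open>\<eta>\<close> on them and
  on a weak limit \<open>l\<close>, whereas orthogonality forces \<open>f l l = 0\<close>.\<close>

lemma finite_eigenvalues: "finite {\<nu> \<in> {0<..\<mu>}. is_eigenvalue W a f \<nu>}" (is "finite ?S")
proof (rule ccontr)
  assume "infinite ?S"
  then obtain \<nu> :: "nat \<Rightarrow> real" where inj: "inj \<nu>" and \<nu>: "range \<nu> \<subseteq> ?S"
    using infinite_countable_subset by blast
  have "\<exists>u\<in>eigenspace W a f (\<nu> k). norm u = 1" for k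
  proof -
    obtain u where u: "u \<in> eigenspace W a f (\<nu> k)" "u \<noteq> 0"
      using \<nu> by (auto simp: is_eigenvalue_iff)
    have "(1 / norm u) *\<^sub>R u \<in> eigenspace W a f (\<nu> k)"
      using u(1) subspace_eigenspace subspace_scale by blast
    moreover have "norm ((1 / norm u) *\<^sub>R u) = 1" using u(2) by simp
    ultimately show ?thesis by blast
  qed
  then obtain e where e: "\<And>k. e k \<in> eigenspace W a f (\<nu> k)" and norm_e: "\<And>k. norm (e k) = 1"
    by metis
  obtain s \<eta> where s: "s > 0" and \<eta>: "\<eta> > 0" and co: "\<And>u. u \<in> W \<Longrightarrow> \<eta> * (norm u)\<^sup>2 \<le> a u u - s * f u u"
    using coercive' by blast
  have lower: "\<eta> \<le> \<mu> * f (e k) (e k)" for k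
  proof -
    have \<nu>k: "0 < \<nu> k" "\<nu> k \<le> \<mu>" using \<nu> by auto
    have eW: "e k \<in> W" using eigenspaceD(1)[OF e] .
    have "e k \<noteq> 0" using norm_e[of k] by auto
    then have "f (e k) (e k) > 0" using eigenvector_f_pos[OF e _ \<nu>k(1)] by blast
    then have "0 < s * f (e k) (e k)" "\<nu> k * f (e k) (e k) \<le> \<mu> * f (e k) (e k)"
      using s \<nu>k(2) by (simp_all add: mult_right_mono)
    then show ?thesis using co[OF eW] eigenspaceD(2)[OF e eW] norm_e[of k] by simp
  qed
  obtain r l where r: "strict_mono r" and l: "weakly_converges (e \<circ> r) l"
    by (rule weak_compactness[of e 1]) (use norm_e in auto)
  have "(\<lambda>k. \<mu> * f ((e \<circ> r) k) ((e \<circ> r) k)) \<longlonglongrightarrow> \<mu> * f l l"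
    by (intro tendsto_mult_left f_limit l)
  then have "\<eta> \<le> \<mu> * f l l" by (rule LIMSEQ_le_const) (use lower in auto)
  \<comment> \<open>Two limits in succession: first in one index with \<open>m\<close> fixed, then
    in \<open>m\<close>.\<close>
  have "f l (e (r m)) = 0" for m
  proof -
    have "(\<lambda>k. f ((e \<circ> r) k) (e (r m))) \<longlonglongrightarrow> f l (e (r m))"
      by (intro f_limit l weakly_converges_const)
    moreover have "\<forall>\<^sub>F k in sequentially. f ((e \<circ> r) k) (e (r m)) = 0"
      using eventually_gt_at_top[of m]
    proof eventually_elim
      case (elim k)
      then have "r k \<noteq> r m" using strict_mono_eq[OF r] by simp
      then have "\<nu> (r k) \<noteq> \<nu> (r m)" using inj by (simp add: inj_eq)
      then show ?case using eigenspace_orthogonal[OF e e] by simp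
    qed
    ultimately show ?thesis by (rule LIMSEQ_unique[OF _ tendsto_eventually])
  qed
  moreover have "(\<lambda>m. f l ((e \<circ> r) m)) \<longlonglongrightarrow> f l l" by (intro f_limit l weakly_converges_const)
  ultimately have "f l l = 0" by (simp add: LIMSEQ_const_iff)
  then show False using \<open>\<eta> \<le> \<mu> * f l l\<close> \<eta> by simp
qed

text \<open>
  If there were fewer than \<open>j\<close> eigenvalues in \<open>(0, \<mu>]\<close>, the \<open>j\<close>-dimensional subspace would contain some
  \<open>u\<^sub>0 \<noteq> 0\<close> that is \<open>f\<close>-orthogonal to their eigenspaces. On the orthogonal complement \<open>X\<close> of the
  eigenspaces, \<open>F\<close> then attains a maximum \<open>m > 0\<close> subject to \<open>A - s F \<le> 1\<close>, and a maximiser is an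
  eigenvector for \<open>s + 1/m \<le> \<mu>\<close>, a contradiction. The map \<open>T\<close> below replaces the orthogonal
  projection: its kernel in \<open>W\<close> is \<open>X\<close>, and it is bijective on the span of the eigenspaces.
\<close>
lemma eigencount_of_dominated:
  assumes \<mu>: "\<mu> > 0" and dom: "dominated W a f \<mu> j"
  shows "enat j \<le> eigencount W a f {0<..\<mu>}"
proof (rule ccontr)
  assume less: "\<not> enat j \<le> eigencount W a f {0<..\<mu>}"
  let ?E = "eigenspace W a f"
  define S where "S = {\<nu> \<in> {0<..\<mu>}. is_eigenvalue W a f \<nu>}"
  have S: "finite S" "S \<subseteq> {0<..\<mu>}" using finite_eigenvalues by (auto simp: S_def)
  have "(\<Sum>\<nu>\<in>S. edim (?E \<nu>)) \<le> eigencount W a f {0<..\<mu>}"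
    using S by (intro eigencount_ge) (auto simp: S_def)
  then have sum_less: "(\<Sum>\<nu>\<in>S. edim (?E \<nu>)) < enat j" using less by simp
  have "\<exists>B. B \<subseteq> ?E \<nu> \<and> independent B \<and> finite B \<and> ?E \<nu> \<subseteq> span B \<and> edim (?E \<nu>) = enat (card B)"
    if \<nu>: "\<nu> \<in> S" for \<nu>
  proof -
    have "edim (?E \<nu>) \<le> (\<Sum>\<nu>\<in>S. edim (?E \<nu>))"
      using S(1) \<nu> by (intro member_le_sum) auto
    then have "edim (?E \<nu>) < enat j" using sum_less by (rule le_less_trans)
    then have "edim (?E \<nu>) \<noteq> \<infinity>" using enat_iless by fastforce
    then obtain B where "B \<subseteq> ?E \<nu>" "independent B" "finite B" "?E \<nu> \<subseteq> span B" "edim (?E \<nu>) = enat (card B)"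
      by (rule edim_basis)
    then show ?thesis by blast
  qed
  then obtain B where B: "\<And>\<nu>. \<nu> \<in> S \<Longrightarrow> B \<nu> \<subseteq> ?E \<nu> \<and> independent (B \<nu>) \<and> finite (B \<nu>)"
    and span_B: "\<And>\<nu>. \<nu> \<in> S \<Longrightarrow> ?E \<nu> \<subseteq> span (B \<nu>)"
    and card_B: "\<And>\<nu>. \<nu> \<in> S \<Longrightarrow> edim (?E \<nu>) = enat (card (B \<nu>))"
    by metis
  define U where "U = \<Union>(B ` S)"
  have U: "independent U" "card U = (\<Sum>\<nu>\<in>S. card (B \<nu>))"
    and U_span: "\<And>u. u \<in> span U \<Longrightarrow> u \<in> W \<and> a u u \<le> \<mu> * f u u"
    using eigenbasis_union[OF S, of B] B by (auto simp: U_def)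
  have finU: "finite U" using S(1) B by (auto simp: U_def)
  have card_U: "card U < j"
    using sum_less sum_edim_enat[OF S(1) card_B] U(2) by simp
  have E_span: "?E \<nu> \<subseteq> span U" if "\<nu> \<in> S" for \<nu>
    using span_B[OF that] span_mono[of "B \<nu>" U] that by (auto simp: U_def)
  define T where "T x = (\<Sum>w\<in>U. f x w *\<^sub>R w)" for x
  have T: "linear T"
    by (rule linearI) (simp_all add: T_def simps scaleR_add_left sum.distrib scaleR_sum_right)
  have T_span: "T x \<in> span U" for x
    unfolding T_def by (intro span_sum span_scale span_base)
  have T_zero: "f x w = 0" if "T x = 0" "w \<in> span U" for x w
    using that(2)
  proof (induction rule: span_induct)
    case base
    show ?case by (rule subspaceI) (auto simp: simps)
  next
    case (step w)
    show ?case using independentD[OF U(1) finU order_refl _ step, of "f x"] that(1)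
      by (simp add: T_def)
  qed
  obtain V where V: "independent V" "finite V" "card V = j"
    and V_span: "\<And>u. u \<in> span V \<Longrightarrow> u \<in> W \<and> a u u \<le> \<mu> * f u u"
    using dom by (auto simp: dominated_def)
  \<comment> \<open>Dimension count: \<open>T\<close> maps the \<open>j\<close>-dimensional
    \<open>span V\<close> into \<open>span U\<close>, whose dimension is less than
    \<open>j\<close>.\<close>
  have "\<exists>u\<in>span V. u \<noteq> 0 \<and> T u = 0"
  proof (rule ccontr)
    assume "\<not> ?thesis"
    then have inj: "inj_on T (span V)"
      using linear_inj_on_iff_eq_0[OF T subspace_span] by auto
    then have "independent (T ` V)" using linear_independent_injective_image[OF T V(1)] by blast
    moreover have "T ` V \<subseteq> span U" using T_span by auto
    ultimately have "card (T ` V) \<le> card U" using independent_span_bound[OF finU] by blast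
    moreover have "card (T ` V) = j"
      using inj_on_subset[OF inj] span_superset V(3) by (metis card_image)
    ultimately show False using card_U by simp
  qed
  then obtain u0 where u0: "u0 \<in> span V" "u0 \<noteq> 0" "T u0 = 0" by blast
  define X where "X = {v \<in> W. \<forall>w\<in>span U. f v w = 0}"
  have X: "subspace X"
    using W by (intro subspaceI) (auto simp: X_def simps subspace_0 subspace_add subspace_scale)
  have u0X: "u0 \<in> X" using u0 V_span T_zero by (auto simp: X_def)
  have fu0: "f u0 u0 > 0" using f_pos[of u0 \<mu>] u0 V_span \<mu> by auto
  obtain s \<eta> where s: "s > 0" and \<eta>: "\<eta> > 0" and co: "\<And>u. u \<in> W \<Longrightarrow> \<eta> * (norm u)\<^sup>2 \<le> a u u - s * f u u"
    using coercive' by blast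
  obtain \<beta> where \<beta>: "\<beta> > 0" "\<And>u. \<bar>f u u\<bar> \<le> \<beta> * (norm u)\<^sup>2"
    using weakly_seq_continuous_bounded[OF f f_cont] by blast
  \<comment> \<open>Coercivity bounds \<open>R\<close>, and with it \<open>f\<close> on
    \<open>R\<close>, so \<open>m\<close> is a finite supremum.\<close>
  define R where "R = {v \<in> X. a v v - s * f v v \<le> 1}"
  define m where "m = Sup ((\<lambda>v. f v v) ` R)"
  have R_norm: "(norm v)\<^sup>2 \<le> 1 / \<eta>" if "v \<in> R" for v
    using co[of v] that \<eta> by (simp add: R_def X_def field_simps)
  have "f v v \<le> \<beta> * (1 / \<eta>)" if "v \<in> R" for v
  proof -
    have "f v v \<le> \<beta> * (norm v)\<^sup>2" using \<beta>(2)[of v] by simp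
    also have "\<dots> \<le> \<beta> * (1 / \<eta>)" using R_norm[OF that] \<beta>(1) by (intro mult_left_mono) auto
    finally show ?thesis .
  qed
  then have bdd: "bdd_above ((\<lambda>v. f v v) ` R)" by (intro bdd_aboveI2)
  have m_ge: "f v v \<le> m" if "v \<in> R" for v
    unfolding m_def using bdd that by (auto intro: cSup_upper)
  \<comment> \<open>Homogeneous form of \<open>f \<le> m\<close> on \<open>R\<close>: a nonzero
    \<open>w\<close> is rescaled until the constraint takes the value 1.\<close>
  have scaled: "f w w \<le> m * (a w w - s * f w w)" if w: "w \<in> X" for w
  proof (cases "w = 0")
    case True then show ?thesis by (simp add: simps)
  next
    case False
    define p where "p = a w w - s * f w w"
    have "0 < \<eta> * (norm w)\<^sup>2" using False \<eta> by simp
    then have p: "p > 0" using co[of w] w by (simp add: p_def X_def)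
    define k where "k = 1 / sqrt p"
    have k: "k\<^sup>2 = 1 / p" using p by (simp add: k_def power_divide)
    have "a (k *\<^sub>R w) (k *\<^sub>R w) - s * f (k *\<^sub>R w) (k *\<^sub>R w) = k\<^sup>2 * p"
      unfolding sym_bilinear_square_scale[OF a] sym_bilinear_square_scale[OF f] p_def by algebra
    then have "k *\<^sub>R w \<in> R" using subspace_scale[OF X w] k p by (simp add: R_def)
    then have "f (k *\<^sub>R w) (k *\<^sub>R w) \<le> m" by (rule m_ge)
    then have "f w w / p \<le> m" unfolding sym_bilinear_square_scale[OF f] k by simp
    then show ?thesis using p by (simp add: p_def[symmetric] pos_divide_le_eq)
  qed
  have "0 < \<eta> * (norm u0)\<^sup>2" using u0(2) \<eta> by simp
  then have pos0: "0 < a u0 u0 - s * f u0 u0" using co[of u0] u0X by (simp add: X_def)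
  have m: "m > 0" using scaled[OF u0X] fu0 pos0 by (smt (verit) mult_nonpos_nonneg)
  \<comment> \<open>Domination enters here: testing \<open>scaled\<close> with \<open>u0\<close>
    yields \<open>1 \<le> m * (\<mu> - s)\<close>, which keeps the new eigenvalue in the range up to
    \<open>\<mu>\<close>.\<close>
  have "f u0 u0 \<le> m * ((\<mu> - s) * f u0 u0)"
  proof -
    have "a u0 u0 - s * f u0 u0 \<le> (\<mu> - s) * f u0 u0"
      using V_span[OF u0(1)] by (simp add: left_diff_distrib)
    then show ?thesis using scaled[OF u0X] m mult_left_mono[of _ _ m] by (meson less_imp_le order_trans)
  qed
  then have "1 \<le> m * (\<mu> - s)" using fu0 by (simp add: mult.assoc[symmetric])
  then have \<kappa>_le: "s + 1 / m \<le> \<mu>" using m by (simp add: field_simps)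
  \<comment> \<open>With this value, \<open>m * (a u u - \<kappa> * f u u)\<close> equals
    \<open>m * (a u u - s * f u u) - f u u\<close>, which is nonnegative on \<open>X\<close> by
    \<open>scaled\<close> and zero at a maximiser. The maximiser is thus a null vector of a
    semidefinite form, which is its Euler-Lagrange equation on \<open>X\<close>.\<close>
  define \<kappa> where "\<kappa> = s + 1 / m"
  have "R \<noteq> {}" using X by (auto simp: R_def simps intro!: exI[of _ 0] subspace_0)
  then have "\<exists>v\<in>R. m - inverse (real (Suc n)) < f v v" for n
    using less_cSup_iff[OF _ bdd, of "m - inverse (real (Suc n))"] unfolding m_def by auto
  then obtain v where vR: "\<And>n. v n \<in> R" and v_large: "\<And>n. m - inverse (real (Suc n)) < f (v n) (v n)"
    by metis
  have "norm (v n) \<le> sqrt (1 / \<eta>)" for n using R_norm[OF vR] by (rule real_le_rsqrt)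
  then obtain r l where r: "strict_mono r" and l: "weakly_converges (v \<circ> r) l"
    by (rule weak_compactness)
  have f_l: "(\<lambda>n. f ((v \<circ> r) n) ((v \<circ> r) n)) \<longlonglongrightarrow> f l l" by (intro f_limit l)
  have lX: "l \<in> X"
    unfolding X_def
  proof (intro CollectI conjI ballI)
    show "l \<in> W" using W_closed[OF _ l] vR by (simp add: R_def X_def)
    fix w assume w: "w \<in> span U"
    have "(\<lambda>n. f ((v \<circ> r) n) w) \<longlonglongrightarrow> f l w" by (intro f_limit l weakly_converges_const)
    moreover have "f ((v \<circ> r) n) w = 0" for n using vR w by (simp add: R_def X_def)
    ultimately show "f l w = 0" by (simp add: LIMSEQ_const_iff)
  qed
  have "m - 0 \<le> f l l"
  proof (rule LIMSEQ_le[OF _ f_l])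
    show "(\<lambda>n. m - inverse (real (Suc (r n)))) \<longlonglongrightarrow> m - 0"
      using LIMSEQ_subseq_LIMSEQ[OF LIMSEQ_inverse_real_of_nat r]
      by (intro tendsto_intros) (simp add: o_def)
    show "\<exists>N. \<forall>n\<ge>N. m - inverse (real (Suc (r n))) \<le> f ((v \<circ> r) n) ((v \<circ> r) n)"
      using v_large by (auto intro: less_imp_le)
  qed
  then have fl: "m \<le> f l l" by simp
  \<comment> \<open>Lower semicontinuity keeps \<open>l\<close> within the constraint, so the
    supremum is attained and \<open>scaled\<close> holds with equality at \<open>l\<close>.\<close>
  have "a l l \<le> 1 + s * f l l"
  proof (rule weak_lower_semicontinuity[OF a a_cont a_nonneg l])
    show "(\<lambda>n. 1 + s * f ((v \<circ> r) n) ((v \<circ> r) n)) \<longlonglongrightarrow> 1 + s * f l l"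
      by (intro tendsto_intros f_l)
    have "a (v n) (v n) \<le> 1 + s * f (v n) (v n)" for n using vR[of n] by (simp add: R_def)
    then show "\<forall>\<^sub>F n in sequentially. a ((v \<circ> r) n) ((v \<circ> r) n) \<le> 1 + s * f ((v \<circ> r) n) ((v \<circ> r) n)"
      by simp
  qed
  then have "m * (a l l - s * f l l) \<le> m * 1" using m by (intro mult_left_mono) auto
  then have "m * (a l l - s * f l l) = f l l" using scaled[OF lX] fl by simp
  then have null: "shifted_form a f \<kappa> l l = 0"
    using m by (simp add: shifted_form_def \<kappa>_def field_simps)
  have on_X: "a l w = \<kappa> * f l w" if w: "w \<in> X" for w
  proof -
    have "shifted_form a f \<kappa> l w = 0"
    proof (rule semidefinite_null_vector[OF sym_bilinear_shifted_form[OF a f] X _ lX null w])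
      fix u assume "u \<in> X"
      then have "f u u \<le> m * (a u u - s * f u u)" by (rule scaled)
      then show "0 \<le> shifted_form a f \<kappa> u u"
        using m by (simp add: shifted_form_def \<kappa>_def field_simps)
    qed
    then show ?thesis by (simp add: shifted_form_def)
  qed
  \<comment> \<open>\<open>f\<close> is positive definite on \<open>span U\<close>, so
    \<open>T\<close> is injective there and, by dimension, maps \<open>span U\<close> onto
    itself.\<close>
  have T_inj: "inj_on T (span U)"
    unfolding linear_inj_on_iff_eq_0[OF T subspace_span]
  proof (intro ballI impI)
    fix x assume x: "x \<in> span U" "T x = 0"
    then have "f x x = 0" using T_zero by blast
    then show "x = 0" using f_pos[of x \<mu>] U_span[OF x(1)] \<mu> by force
  qed
  have TU: "independent (T ` U)" using linear_independent_injective_image[OF T U(1) T_inj] .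
  have card_TU: "card (T ` U) = card U"
    using inj_on_subset[OF T_inj span_superset] by (rule card_image)
  have U_TU: "U \<subseteq> span (T ` U)"
  proof
    fix w assume w: "w \<in> U"
    show "w \<in> span (T ` U)"
    proof (rule ccontr)
      assume not: "w \<notin> span (T ` U)"
      then have "independent (insert w (T ` U))" using TU by (simp add: independent_insertI)
      moreover have "insert w (T ` U) \<subseteq> span U" using T_span w by (auto simp: span_base)
      ultimately have "card (insert w (T ` U)) \<le> card U" using independent_span_bound[OF finU] by blast
      moreover have "w \<notin> T ` U" using not by (auto simp: span_base)
      ultimately show False using card_TU finU by simp
    qed
  qed
  \<comment> \<open>Split \<open>w\<close> into \<open>w - e\<close> in \<open>X\<close> and
    \<open>e\<close> in \<open>span U\<close>. Both forms vanish on the pair \<open>l\<close>,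
    \<open>e\<close>, since \<open>l\<close> is \<open>f\<close>-orthogonal to the eigenvectors that
    span \<open>e\<close>.\<close>
  have "a l w = \<kappa> * f l w" if w: "w \<in> W" for w
  proof -
    have "span U \<subseteq> span (T ` U)" using span_minimal[OF U_TU subspace_span] .
    then have "T w \<in> T ` span U" using T_span linear_span_image[OF T] by blast
    then obtain e where e: "e \<in> span U" "T w = T e" by blast
    have "T (w - e) = 0" using e(2) linear_diff[OF T] by simp
    then have "w - e \<in> X" using T_zero U_span[OF e(1)] w W by (auto simp: X_def subspace_diff)
    then have "a l (w - e) = \<kappa> * f l (w - e)" by (rule on_X)
    moreover have "f l e = 0" using lX e(1) by (simp add: X_def)
    moreover have "a l e = 0"
      using e(1)
    proof (induction rule: span_induct)
      case base
      show ?case by (rule subspaceI) (auto simp: simps)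
    next
      case (step x)
      then obtain \<nu> where \<nu>: "\<nu> \<in> S" "x \<in> ?E \<nu>" using B by (auto simp: U_def)
      have "f l x = 0" using lX step by (simp add: X_def span_base)
      then show ?case
        using eigenspaceD(2)[OF \<nu>(2), of l] lX sym_bilinear_commute[OF a] sym_bilinear_commute[OF f]
        by (simp add: X_def)
    qed
    ultimately show ?thesis by (simp add: simps)
  qed
  then have l_eig: "l \<in> ?E \<kappa>" using lX by (auto simp: eigenspace_def X_def)
  have "l \<noteq> 0" using fl m by (auto simp: simps)
  \<comment> \<open>Now \<open>l\<close> lies in \<open>span U\<close> as well as in
    \<open>X\<close>, so it is \<open>f\<close>-orthogonal to itself.\<close>
  then have "\<kappa> \<in> S" using l_eig \<kappa>_le s m by (auto simp: S_def is_eigenvalue_iff \<kappa>_def add_pos_pos)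
  then have "f l l = 0" using E_span l_eig lX by (auto simp: X_def)
  then show False using fl m by simp
qed

section \<open>Existence and value of the \<open>j\<close>-th positive eigenvalue\<close>

lemma eigencount_iff_dominated:
  assumes "\<mu> > 0" "1 \<le> j"
  shows "enat j \<le> eigencount W a f {0<..\<mu>} \<longleftrightarrow> dominated W a f \<mu> j"
  using assms dominated_of_eigencount eigencount_of_dominated by blast

lemma eigencount_mono: "S \<subseteq> T \<Longrightarrow> eigencount W a f S \<le> eigencount W a f T"
  unfolding eigencount_def by (intro SUP_subset_mono) auto

lemma pos_eigenvalue_exists_iff:
  assumes j: "1 \<le> j"
  shows "pos_eigenvalue_exists W a f j \<longleftrightarrow> (\<exists>\<mu>>0. dominated W a f \<mu> j)"
proof
  assume "pos_eigenvalue_exists W a f j"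
  then have "enat j \<le> eigencount W a f {0<..}"
    by (simp add: pos_eigenvalue_exists_def num_pos_eigenvalues_def)
  then obtain F where F: "finite F" "F \<subseteq> {0<..}" "F \<noteq> {}" "\<forall>\<mu>\<in>F. is_eigenvalue W a f \<mu>"
    "enat j \<le> (\<Sum>\<mu>\<in>F. edim (eigenspace W a f \<mu>))"
    using eigencount_ge_witness[OF j] by metis
  have "(\<Sum>\<mu>\<in>F. edim (eigenspace W a f \<mu>)) \<le> eigencount W a f {0<..Max F}"
    using F by (intro eigencount_ge) auto
  then have "enat j \<le> eigencount W a f {0<..Max F}" using F(5) by simp
  moreover have "Max F > 0" using F Max_in by blast
  ultimately show "\<exists>\<mu>>0. dominated W a f \<mu> j" using dominated_of_eigencount[OF j] by blast
next
  assume "\<exists>\<mu>>0. dominated W a f \<mu> j"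
  then obtain \<mu> where "enat j \<le> eigencount W a f {0<..\<mu>}" using eigencount_of_dominated by blast
  also have "\<dots> \<le> eigencount W a f {0<..}" by (rule eigencount_mono) auto
  finally show "pos_eigenvalue_exists W a f j"
    by (simp add: pos_eigenvalue_exists_def num_pos_eigenvalues_def)
qed

text \<open>\<open>LEAST\<close> on the reals is meaningful only if a minimum exists; it does, since
  \<open>finite_eigenvalues\<close> leaves finitely many candidates below any given one.\<close>

lemma pos_eigenvalue_iff:
  assumes j: "1 \<le> j" and ex: "pos_eigenvalue_exists W a f j"
  shows "0 < pos_eigenvalue W a f j"
    and "\<mu> > 0 \<Longrightarrow> pos_eigenvalue W a f j \<le> \<mu> \<longleftrightarrow> dominated W a f \<mu> j"
proof -
  define Z where "Z = {\<nu>. is_eigenvalue W a f \<nu> \<and> 0 < \<nu> \<and> enat j \<le> eigencount W a f {0<..\<nu>}}"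
  \<comment> \<open>The largest eigenvalue of a finite witness is itself a candidate.\<close>
  have below: "\<exists>\<nu>\<in>Z. \<nu> \<le> \<mu>" if "enat j \<le> eigencount W a f {0<..\<mu>}" for \<mu>
  proof -
    obtain F where F: "finite F" "F \<subseteq> {0<..\<mu>}" "F \<noteq> {}" "\<forall>\<mu>\<in>F. is_eigenvalue W a f \<mu>"
      "enat j \<le> (\<Sum>\<mu>\<in>F. edim (eigenspace W a f \<mu>))"
      using eigencount_ge_witness[OF j \<open>enat j \<le> _\<close>] by metis
    have "(\<Sum>\<mu>\<in>F. edim (eigenspace W a f \<mu>)) \<le> eigencount W a f {0<..Max F}"
      using F by (intro eigencount_ge) auto
    then have "enat j \<le> eigencount W a f {0<..Max F}" using F(5) by simp
    moreover have Max: "Max F \<in> F" using F by simp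
    moreover have "0 < Max F" "Max F \<le> \<mu>" using F(2) Max by auto
    ultimately show ?thesis using F(4) by (intro bexI[of _ "Max F"]) (simp_all add: Z_def)
  qed
  obtain \<mu>0 where "\<mu>0 > 0" "dominated W a f \<mu>0 j" using ex pos_eigenvalue_exists_iff[OF j] by blast
  then obtain \<nu>0 where \<nu>0: "\<nu>0 \<in> Z" using below eigencount_of_dominated by blast
  have fin: "finite (Z \<inter> {..\<nu>0})"
    by (rule finite_subset[OF _ finite_eigenvalues[of \<nu>0]]) (auto simp: Z_def)
  define p where "p = Min (Z \<inter> {..\<nu>0})"
  have pZ: "p \<in> Z" using Min_in[OF fin] \<nu>0 by (auto simp: p_def)
  have p_le: "p \<le> \<nu>" if "\<nu> \<in> Z" for \<nu>
  proof (cases "\<nu> \<le> \<nu>0")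
    case True
    then show ?thesis using that Min_le[OF fin, of \<nu>] by (simp add: p_def)
  next
    case False
    then show ?thesis using Min_le[OF fin, of \<nu>0] \<nu>0 by (simp add: p_def)
  qed
  have eq: "pos_eigenvalue W a f j = p"
    unfolding pos_eigenvalue_def using pZ p_le by (intro Least_equality) (auto simp: Z_def)
  show "0 < pos_eigenvalue W a f j" using pZ by (simp add: eq Z_def)
  assume \<mu>: "\<mu> > 0"
  have "p \<le> \<mu> \<longleftrightarrow> enat j \<le> eigencount W a f {0<..\<mu>}"
  proof
    assume "p \<le> \<mu>"
    then have "eigencount W a f {0<..p} \<le> eigencount W a f {0<..\<mu>}"
      by (intro eigencount_mono) auto
    then show "enat j \<le> eigencount W a f {0<..\<mu>}" using pZ by (auto simp: Z_def)
  next
    assume "enat j \<le> eigencount W a f {0<..\<mu>}"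
    then show "p \<le> \<mu>" using below p_le by force
  qed
  then show "pos_eigenvalue W a f j \<le> \<mu> \<longleftrightarrow> dominated W a f \<mu> j"
    using eigencount_iff_dominated[OF \<mu> j] by (simp add: eq)
qed

end

section \<open>Limits of subspaces\<close>

text \<open>Gram-Schmidt, indexed by naturals so that weak limits can be taken vector by
  vector.\<close>

lemma orthonormal_family:
  fixes B :: "'a::real_inner set"
  assumes B: "independent B" "finite B" "card B = j"
  shows "\<exists>e::nat \<Rightarrow> 'a. span (e ` {..<j}) = span B \<and>
    (\<forall>i<j. \<forall>k<j. inner (e i) (e k) = (if i = k then 1 else 0))"
proof -
  obtain C where C: "finite C" "card C \<le> card B" "span C = span B" "pairwise orthogonal C"
    using basis_orthogonal[OF B(2)] by blast
  have "card B \<le> card C"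
    using independent_span_bound[OF C(1) B(1)] C(3) span_superset by metis
  then have card_C: "card C = j" using C(2) B(3) by simp
  \<comment> \<open>Without the zero vector, \<open>C\<close> would have too few elements to span a
    \<open>j\<close>-dimensional space.\<close>
  have "0 \<notin> C"
  proof
    assume 0: "0 \<in> C"
    have "B \<subseteq> span (C - {0})" using C(3) span_superset by (metis span_delete_0)
    then have "card B \<le> card (C - {0})" using independent_span_bound[OF _ B(1)] C(1) by blast
    then show False using 0 C(1) card_C B(3) by (metis card_Diff1_less linorder_not_le)
  qed
  obtain h where h: "bij_betw h {..<j} C"
    using ex_bij_betw_nat_finite[OF C(1)] card_C by (metis atLeast0LessThan)
  then have hC: "h ` {..<j} = C" and inj: "inj_on h {..<j}" by (auto simp: bij_betw_def)
  have h0: "h i \<noteq> 0" if "i < j" for i using that hC \<open>0 \<notin> C\<close> by force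
  define e where "e i = (1 / norm (h i)) *\<^sub>R h i" for i
  have "span (e ` {..<j}) \<subseteq> span C"
  proof (intro span_minimal subsetI)
    fix x assume "x \<in> e ` {..<j}"
    then obtain i where i: "i < j" "x = e i" by auto
    have "h i \<in> span C" using hC i(1) by (auto intro: span_base)
    then show "x \<in> span C" by (simp add: i(2) e_def span_scale)
  qed auto
  moreover have "span C \<subseteq> span (e ` {..<j})"
  proof (intro span_minimal subsetI)
    fix x assume "x \<in> C"
    then obtain i where i: "i < j" "x = h i" using hC by auto
    then have x: "x = norm (h i) *\<^sub>R e i" using h0 by (simp add: e_def)
    have "e i \<in> span (e ` {..<j})" using i(1) by (auto intro: span_base)
    then show "x \<in> span (e ` {..<j})" unfolding x by (rule span_scale)
  qed auto
  moreover have "inner (e i) (e k) = (if i = k then 1 else 0)" if ik: "i < j" "k < j" for i k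
  proof (cases "i = k")
    case True
    then show ?thesis using h0[OF ik(1)] by (simp add: e_def dot_square_norm power2_eq_square)
  next
    case False
    then have "h i \<noteq> h k" using inj ik by (auto simp: inj_on_def)
    then have "inner (h i) (h k) = 0"
      using C(4) hC ik by (auto simp: pairwise_def orthogonal_def)
    then show ?thesis using False by (simp add: e_def)
  qed
  ultimately show ?thesis using C(3) by blast
qed

lemma norm_orthonormal_sum:
  fixes e :: "nat \<Rightarrow> 'a::real_inner"
  assumes "\<forall>i<j. \<forall>k<j. inner (e i) (e k) = (if i = k then 1 else 0)"
  shows "(norm (\<Sum>i<j. x i *\<^sub>R e i))\<^sup>2 = (\<Sum>i<j. (x i)\<^sup>2)"
proof -
  have "(norm (\<Sum>i<j. x i *\<^sub>R e i))\<^sup>2 = (\<Sum>i<j. \<Sum>k<j. x i * (x k * inner (e i) (e k)))"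
    unfolding power2_norm_eq_inner inner_sum_left inner_sum_right
    by (intro sum.cong refl) (simp add: inner_commute)
  also have "\<dots> = (\<Sum>i<j. \<Sum>k<j. if k = i then (x i)\<^sup>2 else 0)"
    using assms by (intro sum.cong refl) (auto simp: power2_eq_square)
  also have "\<dots> = (\<Sum>i<j. (x i)\<^sup>2)" by (intro sum.cong refl) simp
  finally show ?thesis .
qed

lemma independent_family:
  fixes l :: "nat \<Rightarrow> 'a::real_vector"
  assumes zero: "\<And>x. (\<Sum>i<j. x i *\<^sub>R l i) = 0 \<Longrightarrow> \<forall>i<j. x i = 0"
  shows "independent (l ` {..<j})" "card (l ` {..<j}) = j"
    and "u \<in> span (l ` {..<j}) \<Longrightarrow> \<exists>x. u = (\<Sum>i<j. x i *\<^sub>R l i)"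
proof -
  have inj: "inj_on l {..<j}"
  proof (rule inj_onI, rule ccontr)
    fix i k assume ik: "i \<in> {..<j}" "k \<in> {..<j}" "l i = l k" "i \<noteq> k"
    let ?x = "\<lambda>n. if n = i then 1 else if n = k then - 1 else (0::real)"
    have "(\<Sum>n<j. ?x n *\<^sub>R l n) = (\<Sum>n\<in>{i, k}. ?x n *\<^sub>R l n)"
      using ik by (intro sum.mono_neutral_right) auto
    also have "\<dots> = 0" using ik by simp
    finally have "?x i = 0" using zero[of ?x] ik(1) by blast
    then show False by simp
  qed
  show "card (l ` {..<j}) = j" by (simp add: card_image[OF inj])
  show "independent (l ` {..<j})"
  proof (rule independent_if_scalars_zero)
    fix g v assume g: "(\<Sum>x\<in>l ` {..<j}. g x *\<^sub>R x) = 0" and v: "v \<in> l ` {..<j}"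
    have "(\<Sum>i<j. g (l i) *\<^sub>R l i) = 0" using g by (simp add: sum.reindex[OF inj])
    then have "\<forall>i<j. g (l i) = 0" by (rule zero)
    then show "g v = 0" using v by auto
  qed simp
  assume "u \<in> span (l ` {..<j})"
  then obtain g where "u = (\<Sum>x\<in>l ` {..<j}. g x *\<^sub>R x)" by (auto simp: span_finite)
  then show "\<exists>x. u = (\<Sum>i<j. x i *\<^sub>R l i)"
    by (intro exI[of _ "\<lambda>i. g (l i)"]) (simp add: sum.reindex[OF inj])
qed

lemma simultaneous_weak_compactness:
  fixes e :: "nat \<Rightarrow> nat \<Rightarrow> 'a::{real_inner, complete_space}"
  assumes "\<And>n i. i < j \<Longrightarrow> norm (e n i) \<le> M"
  shows "\<exists>r l. strict_mono r \<and> (\<forall>i<j. weakly_converges (\<lambda>n. e (r n) i) (l i))"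
  using assms
proof (induction j)
  case 0
  show ?case by (intro exI[of _ id]) (simp add: strict_mono_def)
next
  case (Suc j)
  have "\<exists>r l. strict_mono r \<and> (\<forall>i<j. weakly_converges (\<lambda>n. e (r n) i) (l i))"
    using Suc.prems by (intro Suc.IH) simp
  then obtain r l where r: "strict_mono r" and l: "\<And>i. i < j \<Longrightarrow> weakly_converges (\<lambda>n. e (r n) i) (l i)"
    by blast
  obtain r' l' where r': "strict_mono r'" and l': "weakly_converges ((\<lambda>n. e (r n) j) \<circ> r') l'"
    by (rule weak_compactness[of "\<lambda>n. e (r n) j" M]) (use Suc.prems in auto)
  have "weakly_converges (\<lambda>n. e ((r \<circ> r') n) i) ((l(j := l')) i)" if "i < Suc j" for i
  proof (cases "i = j")
    case True
    then show ?thesis using l' by (simp add: o_def)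
  next
    case False
    then show ?thesis using that weakly_converges_subseq[OF l r', of i] by (simp add: o_def)
  qed
  then show ?case using strict_mono_o[OF r r'] by blast
qed

text \<open>Orthonormal bases converge weakly, vector by vector, along a common subsequence. Fixed
  coefficients give vectors of constant norm \<open>\<kappa>\<close>. Weak limits alone may lose
  dimension; that limits with \<open>\<kappa> > 0\<close> are nonzero keeps the limit family
  independent.\<close>

lemma limit_subspace:
  fixes B :: "nat \<Rightarrow> 'a::{real_inner, complete_space} set"
  assumes B: "\<And>n. independent (B n) \<and> finite (B n) \<and> card (B n) = j"
    and limit: "\<And>r u l \<kappa>. strict_mono r \<Longrightarrow> \<forall>n. u n \<in> span (B (r n)) \<Longrightarrow> \<forall>n. norm (u n) = \<kappa> \<Longrightarrow>
      weakly_converges u l \<Longrightarrow> P l \<and> (\<kappa> > 0 \<longrightarrow> l \<noteq> 0)"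
  shows "\<exists>B. independent B \<and> finite B \<and> card B = j \<and> (\<forall>u\<in>span B. P u)"
proof -
  have "\<exists>e::nat \<Rightarrow> 'a. span (e ` {..<j}) = span (B n) \<and>
    (\<forall>i<j. \<forall>k<j. inner (e i) (e k) = (if i = k then 1 else 0))" for n
    using orthonormal_family[of "B n" j] B by blast
  then obtain e :: "nat \<Rightarrow> nat \<Rightarrow> 'a" where e_span: "\<And>n. span (e n ` {..<j}) = span (B n)"
    and e: "\<And>n. \<forall>i<j. \<forall>k<j. inner (e n i) (e n k) = (if i = k then 1 else 0)"
    by metis
  have "norm (e n i) \<le> 1" if "i < j" for n i using e[of n] that by (simp add: norm_eq_sqrt_inner)
  then obtain r l where r: "strict_mono r" and l: "\<And>i. i < j \<Longrightarrow> weakly_converges (\<lambda>n. e (r n) i) (l i)"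
    using simultaneous_weak_compactness[of j e 1] by blast
  have key: "P (\<Sum>i<j. x i *\<^sub>R l i) \<and> (sqrt (\<Sum>i<j. (x i)\<^sup>2) > 0 \<longrightarrow> (\<Sum>i<j. x i *\<^sub>R l i) \<noteq> 0)" for x
  proof (rule limit[OF r])
    let ?u = "\<lambda>n. \<Sum>i<j. x i *\<^sub>R e (r n) i"
    have "?u n \<in> span (e (r n) ` {..<j})" for n
      by (intro span_sum span_scale span_base) auto
    then show "\<forall>n. ?u n \<in> span (B (r n))" by (simp add: e_span)
    show "\<forall>n. norm (?u n) = sqrt (\<Sum>i<j. (x i)\<^sup>2)"
      by (intro allI real_sqrt_unique[symmetric] norm_orthonormal_sum[OF e] norm_ge_zero)
    show "weakly_converges ?u (\<Sum>i<j. x i *\<^sub>R l i)"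
      by (intro weakly_converges_scaleR_sum l) simp
  qed
  have zero: "\<forall>i<j. x i = 0" if "(\<Sum>i<j. x i *\<^sub>R l i) = 0" for x :: "nat \<Rightarrow> real"
  proof -
    have "(\<Sum>i<j. (x i)\<^sup>2) \<le> 0" using key[of x] that by auto
    moreover have "0 \<le> (\<Sum>i<j. (x i)\<^sup>2)" by (simp add: sum_nonneg)
    ultimately have "(\<Sum>i<j. (x i)\<^sup>2) = 0" by simp
    then show ?thesis by (simp add: sum_nonneg_eq_0_iff)
  qed
  note family = independent_family[where j = j and l = l, OF zero]
  have "P u" if "u \<in> span (l ` {..<j})" for u
    using family(3)[OF _ that] key by blast
  then show ?thesis using family(1,2) by (intro exI[of _ "l ` {..<j}"]) simp
qed

text \<open>By monotonicity, an upper bound \<open>L\<close> and a single value above each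
  \<open>M < L\<close> give the limit; extended reals treat finite and infinite \<open>s\<close> and
  \<open>L\<close> alike.\<close>

lemma increases_toI:
  assumes mono: "mono_on D g" and D: "\<And>t. t0 \<le> t \<Longrightarrow> ereal t < s \<Longrightarrow> t \<in> D" and s: "ereal t0 < s"
    and le: "\<And>t. t0 \<le> t \<Longrightarrow> ereal t < s \<Longrightarrow> ereal (g t) \<le> L"
    and large: "\<And>M. ereal M < L \<Longrightarrow> \<exists>t\<ge>t0. ereal t < s \<and> M < g t"
  shows "increases_to g D s L"
  unfolding increases_to_def
proof (intro conjI mono order_tendstoI)
  fix y assume "y < L"
  then obtain M where M: "y < ereal M" "ereal M < L" using ereal_dense2 by blast
  obtain t1 where t1: "t0 \<le> t1" "ereal t1 < s" "M < g t1" using large[OF M(2)] by blast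
  have "y < ereal (g (real_of_ereal x))" if x: "ereal t1 < x" "x < s" for x
  proof -
    obtain t where t: "x = ereal t" using x by (cases x) auto
    have "g t1 \<le> g t" using x t t1 by (intro mono_onD[OF mono] D) auto
    then have "ereal M < ereal (g t)" using t1(3) by simp
    then show ?thesis using M(1) t by (auto intro: less_trans)
  qed
  then show "\<forall>\<^sub>F x in at_left s. y < ereal (g (real_of_ereal x))"
    using eventually_at_left[OF t1(2)] t1(2) by blast
next
  fix y assume y: "L < y"
  have "ereal (g (real_of_ereal x)) < y" if x: "ereal t0 < x" "x < s" for x
  proof -
    obtain t where t: "x = ereal t" using x by (cases x) auto
    then have "ereal (g t) \<le> L" using x by (intro le) auto
    then show ?thesis using y t by simp
  qed
  then show "\<forall>\<^sub>F x in at_left s. ereal (g (real_of_ereal x)) < y"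
    using eventually_at_left[OF s] s by blast
qed

section \<open>Dependence of the eigenvalues on the parameter\<close>

text \<open>\<open>I\<close> stands for the whole line in the fixed case and for a half-line in the
  moving case; the shift \<open>s\<close> may depend on \<open>t\<close>.\<close>

locale spectral_family =
  fixes a b c :: "'a::{real_inner, complete_space} \<Rightarrow> 'a \<Rightarrow> real" and I :: "real set"
  assumes a: "sym_bilinear a" and b: "sym_bilinear b" and c: "sym_bilinear c"
    and a_cont: "jointly_continuous a" and b_cont: "weakly_seq_continuous b"
    and c_cont: "weakly_seq_continuous c"
    and a_nonneg: "\<And>u. 0 \<le> a u u" and c_nonneg: "\<And>u. 0 \<le> c u u"
    and I_ne: "I \<noteq> {}" and I_up: "\<And>t t'. t \<in> I \<Longrightarrow> t \<le> t' \<Longrightarrow> t' \<in> I"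
    and coercive: "\<And>t. t \<in> I \<Longrightarrow> \<exists>s>0. coercive_on UNIV (shifted_form a (shifted_form b c t) s)"
begin

lemma spectral_pair_shifted:
  assumes "t \<in> I"
  shows "spectral_pair UNIV a (shifted_form b c t)"
  using a b c a_cont b_cont c_cont a_nonneg coercive[OF assms]
  by unfold_locales (simp_all add: sym_bilinear_shifted_form weakly_seq_continuous_shifted_form)

lemma Ker_null: "u \<in> Ker c \<Longrightarrow> c u v = 0"
  by (simp add: Ker_def)

lemma Ker_iff: "u \<in> Ker c \<longleftrightarrow> c u u = 0"
  using semidefinite_null_vector[OF c subspace_UNIV c_nonneg UNIV_I] by (auto simp: Ker_def)

text \<open>On \<open>Ker c\<close> the shifted form is \<open>b\<close> for every \<open>t\<close>,
  so coercivity is inherited from any one parameter in \<open>I\<close>.\<close>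

lemma spectral_pair_Ker: "spectral_pair (Ker c) a b"
proof unfold_locales
  show "subspace (Ker c)"
    by (rule subspaceI) (auto simp: Ker_def sym_bilinear_simps[OF c])
  show "l \<in> Ker c" if x: "\<And>n. x n \<in> Ker c" and l: "weakly_converges x l" for x l
    unfolding Ker_def
  proof (intro CollectI allI)
    fix v
    have "(\<lambda>n. c (x n) v) \<longlonglongrightarrow> c l v"
      using c_cont l weakly_converges_const unfolding weakly_seq_continuous_def by blast
    then show "c l v = 0" by (simp add: Ker_null[OF x] LIMSEQ_const_iff)
  qed
  obtain t where "t \<in> I" using I_ne by blast
  then obtain s where "s > 0" "coercive_on UNIV (shifted_form a (shifted_form b c t) s)"
    using coercive by blast
  then have "coercive_on (Ker c) (shifted_form a b s)"
    unfolding coercive_on_def shifted_form_def by (metis Ker_null UNIV_I diff_zero mult_zero_right)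
  then show "\<exists>s>0. coercive_on (Ker c) (shifted_form a b s)" using \<open>s > 0\<close> by blast
qed (use a b a_cont b_cont a_nonneg in auto)

section \<open>Domination as a condition on the parameter\<close>

abbreviation dom :: "real \<Rightarrow> real \<Rightarrow> nat \<Rightarrow> bool" where
  "dom t \<equiv> dominated UNIV a (shifted_form b c t)"

lemma dom_def: "dom t M j \<longleftrightarrow>
   (\<exists>B. independent B \<and> finite B \<and> card B = j \<and> (\<forall>u\<in>span B. a u u \<le> M * (b u u - t * c u u)))"
  by (simp add: dominated_def shifted_form_def)

lemma dom_antimono:
  assumes "dom t' M j" "t \<le> t'" "0 \<le> M"
  shows "dom t M j"
proof -
  have "M * (b u u - t' * c u u) \<le> M * (b u u - t * c u u)" for u
    using assms(2,3) c_nonneg[of u] by (intro mult_left_mono diff_left_mono mult_right_mono) auto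
  moreover obtain B where "independent B" "finite B" "card B = j"
    "\<forall>u\<in>span B. a u u \<le> M * (b u u - t' * c u u)"
    using assms(1) unfolding dom_def by blast
  ultimately show ?thesis unfolding dom_def by (intro exI[of _ B]) (auto intro: order_trans)
qed

text \<open>Test spaces for parameters tending to \<open>tj\<close> have a limit space. Each
  \<open>t < tj\<close> is eventually passed, and the inequality at a larger parameter implies the
  one at \<open>t\<close>, so a single space serves all \<open>t\<close>.\<close>

lemma dom_limit:
  assumes t0: "t0 \<in> I" and tj: "ereal t0 < tj" and M: "0 \<le> M"
    and dom: "\<And>t. t0 \<le> t \<Longrightarrow> ereal t < tj \<Longrightarrow> dom t M j"
  shows "\<exists>B. independent B \<and> finite B \<and> card B = j \<and>
    (\<forall>u\<in>span B. \<forall>t. t0 \<le> t \<longrightarrow> ereal t < tj \<longrightarrow> a u u \<le> M * (b u u - t * c u u))"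
proof -
  obtain X where X: "\<And>n. ereal t0 < ereal (X n)" "\<And>n. ereal (X n) < tj" and X_lim: "(\<lambda>n. ereal (X n)) \<longlonglongrightarrow> tj"
    by (rule ereal_incseq_approx[OF tj]) blast
  have "\<forall>n. \<exists>B. independent B \<and> finite B \<and> card B = j \<and>
      (\<forall>u\<in>span B. a u u \<le> M * (b u u - X n * c u u))"
    using dom X unfolding dom_def by (simp add: less_imp_le)
  then obtain B where B: "\<And>n. independent (B n) \<and> finite (B n) \<and> card (B n) = j"
    and B_span: "\<And>n u. u \<in> span (B n) \<Longrightarrow> a u u \<le> M * (b u u - X n * c u u)"
    by metis
  have B_span': "a u u \<le> M * (b u u - t * c u u)" if "u \<in> span (B n)" "t \<le> X n" for u n t
  proof -
    have "M * (b u u - X n * c u u) \<le> M * (b u u - t * c u u)"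
      using that(2) M c_nonneg[of u] by (intro mult_left_mono diff_left_mono mult_right_mono) auto
    then show ?thesis using B_span[OF that(1)] by simp
  qed
  have pair_limit: "(\<lambda>n. K * (b (u n) (u n) - t * c (u n) (u n))) \<longlonglongrightarrow> K * (b l l - t * c l l)"
    if "weakly_converges u l" for u :: "nat \<Rightarrow> 'a" and l t K
    using that b_cont c_cont unfolding weakly_seq_continuous_def
    by (intro tendsto_mult_left tendsto_diff) blast+
  obtain s \<eta> where s: "s > 0" and \<eta>: "\<eta> > 0"
    and co: "\<And>u. \<eta> * (norm u)\<^sup>2 \<le> a u u - s * (b u u - t0 * c u u)"
    using coercive[OF t0] by (auto simp: coercive_on_def shifted_form_def)
  show ?thesis
  proof (rule limit_subspace[OF B])
    fix r :: "nat \<Rightarrow> nat" and u :: "nat \<Rightarrow> 'a" and l :: 'a and \<kappa> :: real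
    assume r: "strict_mono r" and u: "\<forall>n. u n \<in> span (B (r n))" and \<kappa>: "\<forall>n. norm (u n) = \<kappa>"
      and l: "weakly_converges u l"
    have "a l l \<le> M * (b l l - t * c l l)" if t: "t0 \<le> t" "ereal t < tj" for t
    proof (rule weak_lower_semicontinuity[OF a a_cont a_nonneg l _ pair_limit[OF l]])
      have "(\<lambda>n. ereal (X (r n))) \<longlonglongrightarrow> tj" using LIMSEQ_subseq_LIMSEQ[OF X_lim r] by (simp add: o_def)
      then have "\<forall>\<^sub>F n in sequentially. ereal t < ereal (X (r n))" using t(2) by (rule order_tendstoD)
      then show "\<forall>\<^sub>F n in sequentially. a (u n) (u n) \<le> M * (b (u n) (u n) - t * c (u n) (u n))"
        by eventually_elim (use u in \<open>auto intro!: B_span'\<close>)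
    qed
    \<comment> \<open>Coercivity at \<open>t0\<close> bounds the constant norm by a weakly
      continuous quantity, which would tend to 0 if \<open>l\<close> were 0.\<close>
    moreover have "l \<noteq> 0" if "\<kappa> > 0"
    proof
      assume "l = 0"
      have "\<eta> * \<kappa>\<^sup>2 \<le> (M - s) * (b (u n) (u n) - t0 * c (u n) (u n))" for n
      proof -
        have "a (u n) (u n) \<le> M * (b (u n) (u n) - t0 * c (u n) (u n))"
          using u X(1)[of "r n"] by (intro B_span'[of _ "r n"]) auto
        then show ?thesis using co[of "u n"] \<kappa> by (simp add: left_diff_distrib)
      qed
      then have "\<eta> * \<kappa>\<^sup>2 \<le> (M - s) * (b l l - t0 * c l l)"
        by (intro LIMSEQ_le_const[OF pair_limit[OF l]]) blast
      then have "\<eta> * \<kappa>\<^sup>2 \<le> 0"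
        by (simp add: \<open>l = 0\<close> sym_bilinear_simps[OF b] sym_bilinear_simps[OF c])
      moreover have "0 < \<eta> * \<kappa>\<^sup>2" using \<eta> that by simp
      ultimately show False by simp
    qed
    ultimately show "(\<forall>t. t0 \<le> t \<longrightarrow> ereal t < tj \<longrightarrow> a l l \<le> M * (b l l - t * c l l)) \<and> (\<kappa> > 0 \<longrightarrow> l \<noteq> 0)"
      by blast
  qed
qed

lemma dom_limit_infinity:
  assumes t0: "t0 \<in> I" and M: "0 < M" and dom: "\<And>t. t0 \<le> t \<Longrightarrow> dom t M j"
  shows "dominated (Ker c) a b M j"
proof -
  have "\<exists>B. independent B \<and> finite B \<and> card B = j \<and>
    (\<forall>u\<in>span B. \<forall>t. t0 \<le> t \<longrightarrow> ereal t < \<infinity> \<longrightarrow> a u u \<le> M * (b u u - t * c u u))"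
    using M dom by (intro dom_limit[OF t0]) auto
  then obtain B where B: "independent B" "finite B" "card B = j"
    and le: "\<And>u t. u \<in> span B \<Longrightarrow> t0 \<le> t \<Longrightarrow> a u u \<le> M * (b u u - t * c u u)"
    by auto
  have "u \<in> Ker c \<and> a u u \<le> M * b u u" if u: "u \<in> span B" for u
  proof -
    have "c u u = 0"
    proof (rule ccontr)
      assume "c u u \<noteq> 0"
      then have pos: "c u u > 0" using c_nonneg[of u] by simp
      \<comment> \<open>Large enough that \<open>b u u - t * c u u\<close> is at most -1, which
        \<open>a_nonneg\<close> forbids.\<close>
      define t where "t = max t0 ((b u u + 1) / c u u)"
      have "(b u u + 1) / c u u \<le> t" by (simp add: t_def)
      then have "b u u + 1 \<le> t * c u u" using pos by (simp add: pos_divide_le_eq)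
      then have "M * (b u u - t * c u u) < 0" using M by (intro mult_pos_neg) auto
      moreover have "a u u \<le> M * (b u u - t * c u u)" using le[OF u] by (simp add: t_def)
      ultimately show False using a_nonneg[of u] by linarith
    qed
    then show ?thesis using le[OF u order_refl] by (simp add: Ker_iff)
  qed
  then show ?thesis unfolding dominated_def using B by blast
qed

text \<open>For each fixed \<open>u\<close> of the limit space the inequality is affine in
  \<open>t\<close>, so it extends to the endpoint.\<close>

lemma dom_limit_finite:
  assumes t0: "t0 \<in> I" "t0 < \<tau>" and M: "0 < M" and dom: "\<And>t. t0 \<le> t \<Longrightarrow> t < \<tau> \<Longrightarrow> dom t M j"
  shows "dom \<tau> M j"
proof -
  have "\<exists>B. independent B \<and> finite B \<and> card B = j \<and>
    (\<forall>u\<in>span B. \<forall>t. t0 \<le> t \<longrightarrow> ereal t < ereal \<tau> \<longrightarrow> a u u \<le> M * (b u u - t * c u u))"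
    using t0 M dom by (intro dom_limit) auto
  then obtain B where B: "independent B" "finite B" "card B = j"
    and le: "\<And>u t. u \<in> span B \<Longrightarrow> t0 \<le> t \<Longrightarrow> t < \<tau> \<Longrightarrow> a u u \<le> M * (b u u - t * c u u)"
    by auto
  have "a u u \<le> M * (b u u - \<tau> * c u u)" if u: "u \<in> span B" for u
  proof (rule tendsto_lowerbound)
    show "((\<lambda>t. M * (b u u - t * c u u)) \<longlongrightarrow> M * (b u u - \<tau> * c u u)) (at_left \<tau>)"
      by (intro tendsto_intros)
    show "\<forall>\<^sub>F t in at_left \<tau>. a u u \<le> M * (b u u - t * c u u)"
      using eventually_at_left_real[OF t0(2)] by eventually_elim (use le[OF u] in auto)
  qed simp
  then show ?thesis unfolding dom_def using B by blast
qed

text \<open>Doubling \<open>M\<close> creates slack: on the test space, coercivity makes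
  \<open>M * (b u u - t * c u u)\<close> at least \<open>\<eta>\<close> times the squared norm,
  which absorbs a small increase of \<open>t\<close>.\<close>

lemma dom_open:
  assumes t: "t \<in> I" and M: "0 < M" and "dom t M j"
  shows "\<exists>t'>t. \<exists>M'>0. dom t' M' j"
proof -
  obtain B where B: "independent B" "finite B" "card B = j"
    and le: "\<And>u. u \<in> span B \<Longrightarrow> a u u \<le> M * (b u u - t * c u u)"
    using assms(3) by (auto simp: dom_def)
  obtain s \<eta> where s: "s > 0" and \<eta>: "\<eta> > 0"
    and co: "\<And>u. \<eta> * (norm u)\<^sup>2 \<le> a u u - s * (b u u - t * c u u)"
    using coercive[OF t] by (auto simp: coercive_on_def shifted_form_def)
  obtain \<gamma> where \<gamma>: "\<gamma> > 0" "\<And>u. \<bar>c u u\<bar> \<le> \<gamma> * (norm u)\<^sup>2"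
    using weakly_seq_continuous_bounded[OF c c_cont] by blast
  \<comment> \<open>Makes the cost \<open>2 * M * \<epsilon> * c u u\<close> at most
    \<open>\<eta>\<close> times the squared norm.\<close>
  define \<epsilon> where "\<epsilon> = \<eta> / (2 * M * \<gamma>)"
  have \<epsilon>: "\<epsilon> > 0" using \<eta> M \<gamma>(1) by (simp add: \<epsilon>_def)
  have "a u u \<le> (2 * M) * (b u u - (t + \<epsilon>) * c u u)" if u: "u \<in> span B" for u
  proof -
    let ?F = "b u u - t * c u u"
    have "0 \<le> M * ?F" using le[OF u] a_nonneg[of u] by linarith
    then have "0 \<le> ?F" using M by (simp add: zero_le_mult_iff)
    then have "0 \<le> s * ?F" using s by simp
    then have "\<eta> * (norm u)\<^sup>2 \<le> M * ?F" using co[of u] le[OF u] by linarith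
    moreover have "(2 * M) * (\<epsilon> * c u u) \<le> \<eta> * (norm u)\<^sup>2"
    proof -
      have "(2 * M) * (\<epsilon> * c u u) = (\<eta> / \<gamma>) * c u u" using M by (simp add: \<epsilon>_def)
      also have "\<dots> \<le> (\<eta> / \<gamma>) * (\<gamma> * (norm u)\<^sup>2)"
        using \<gamma>(2)[of u] \<eta> \<gamma>(1) by (intro mult_left_mono) auto
      finally show ?thesis using \<gamma>(1) by simp
    qed
    moreover have "(2 * M) * (b u u - (t + \<epsilon>) * c u u) = 2 * (M * ?F) - (2 * M) * (\<epsilon> * c u u)"
      by algebra
    ultimately show ?thesis using le[OF u] by linarith
  qed
  then have "dom (t + \<epsilon>) (2 * M) j" unfolding dom_def using B by blast
  moreover have "t < t + \<epsilon>" "0 < 2 * M" using \<epsilon> M by simp_all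
  ultimately show ?thesis by blast
qed

section \<open>The \<open>j\<close>-th eigenvalue along the family\<close>

context
  fixes j :: nat
  assumes j: "1 \<le> j"
begin

abbreviation "ex t \<equiv> pos_eigenvalue_exists UNIV a (shifted_form b c t) j"
abbreviation "ev t \<equiv> pos_eigenvalue UNIV a (shifted_form b c t) j"

lemma ex_iff: "t \<in> I \<Longrightarrow> ex t \<longleftrightarrow> (\<exists>M>0. dom t M j)"
  using spectral_pair.pos_eigenvalue_exists_iff[OF spectral_pair_shifted j] .

lemma ev_pos: "t \<in> I \<Longrightarrow> ex t \<Longrightarrow> 0 < ev t"
  using spectral_pair.pos_eigenvalue_iff(1)[OF spectral_pair_shifted j] .

lemma ev_le_iff: "t \<in> I \<Longrightarrow> ex t \<Longrightarrow> 0 < M \<Longrightarrow> ev t \<le> M \<longleftrightarrow> dom t M j"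
  using spectral_pair.pos_eigenvalue_iff(2)[OF spectral_pair_shifted j] .

lemma ex_antimono:
  assumes "t \<in> I" "t \<le> t'" "ex t'"
  shows "ex t"
  using assms dom_antimono ex_iff[OF assms(1)] ex_iff[OF I_up[OF assms(1,2)]]
  by (meson less_imp_le)

lemma ev_mono: "mono_on {t \<in> I. ex t} ev"
proof (rule mono_onI)
  fix t t' assume t: "t \<in> {t \<in> I. ex t}" "t' \<in> {t \<in> I. ex t}" "t \<le> t'"
  then have pos: "0 < ev t'" using ev_pos by simp
  then have "dom t' (ev t') j" using ev_le_iff[of t' "ev t'"] t(2) by simp
  then have "dom t (ev t') j" using dom_antimono t(3) pos by simp
  then show "ev t \<le> ev t'" using ev_le_iff[of t "ev t'"] pos t(1) by simp
qed

text \<open>A test space inside \<open>Ker c\<close> works for every \<open>t\<close>, which gives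
  existence and the upper bound. If the eigenvalues stayed below some \<open>M < L\<close>, the
  limit space would show \<open>L \<le> M\<close>.\<close>

lemma converges_to_Ker_eigenvalue:
  assumes "pos_eigenvalue_exists (Ker c) a b j"
  shows "\<forall>t\<in>I. ex t" and "increases_to ev I \<infinity> (ereal (pos_eigenvalue (Ker c) a b j))"
proof -
  define L where "L = pos_eigenvalue (Ker c) a b j"
  have L: "L > 0" and L_le: "\<And>M. 0 < M \<Longrightarrow> L \<le> M \<longleftrightarrow> dominated (Ker c) a b M j"
    using spectral_pair.pos_eigenvalue_iff[OF spectral_pair_Ker j assms] by (simp_all add: L_def)
  have "dominated (Ker c) a b L j" using L_le[OF L] by simp
  then have dom_L: "dom t L j" for t
    unfolding dominated_def shifted_form_def by (force simp: Ker_null)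
  then show ex: "\<forall>t\<in>I. ex t" using ex_iff L by blast
  have le: "ev t \<le> L" if "t \<in> I" for t using ev_le_iff[OF that _ L] ex that dom_L by blast
  obtain t0 where t0: "t0 \<in> I" using I_ne by blast
  have "increases_to ev I \<infinity> (ereal L)"
  proof (rule increases_toI[of _ _ t0])
    show "mono_on I ev" using ev_mono ex by (simp add: Collect_conj_eq Int_absorb2 subset_eq)
    fix M assume "ereal M < ereal L"
    show "\<exists>t\<ge>t0. ereal t < \<infinity> \<and> M < ev t"
    proof (rule ccontr)
      assume "\<not> ?thesis"
      then have M: "ev t \<le> M" if "t0 \<le> t" for t using that by (auto simp: not_less)
      have "0 < ev t0" using ev_pos t0 ex by blast
      then have "0 < M" using M[of t0] by simp
      then have "dom t M j" if "t0 \<le> t" for t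
        using M[OF that] ev_le_iff[of t M] I_up[OF t0 that] ex by blast
      then have "dominated (Ker c) a b M j" by (rule dom_limit_infinity[OF t0 \<open>0 < M\<close>])
      then have "L \<le> M" using L_le[OF \<open>0 < M\<close>] by simp
      then show False using \<open>ereal M < ereal L\<close> by simp
    qed
  qed (use le I_up[OF t0] in auto)
  then show "increases_to ev I \<infinity> (ereal (pos_eigenvalue (Ker c) a b j))" by (simp add: L_def)
qed

lemma diverges:
  assumes not: "\<not> pos_eigenvalue_exists (Ker c) a b j" and t0: "t0 \<in> I" and ex_t0: "ex t0"
  shows "\<exists>tj::ereal. ereal t0 < tj \<and> (\<forall>t. t0 \<le> t \<longrightarrow> ereal t < tj \<longrightarrow> ex t) \<and>
    increases_to ev {t \<in> I. ex t} tj \<infinity>"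
proof -
  \<comment> \<open>Openness of existence puts every parameter of existence strictly below this
    supremum, and antitonicity fills the gap between \<open>t0\<close> and it.\<close>
  define tj where "tj = Sup (ereal ` {t \<in> I. ex t})"
  have beyond: "ereal t < tj" if t: "t \<in> I" "ex t" for t
  proof -
    obtain M where "M > 0" "dom t M j" using ex_iff t by blast
    then obtain t' M' where t': "t < t'" "M' > 0" "dom t' M' j" using dom_open[OF t(1)] by blast
    then have "t' \<in> I" using I_up[OF t(1)] by simp
    then have "t' \<in> {t \<in> I. ex t}" using ex_iff t' by blast
    then have "ereal t' \<le> tj" unfolding tj_def by (intro Sup_upper imageI)
    then show ?thesis using t'(1) by (metis ereal_less(2) less_ereal.simps(1) order_less_le_trans)
  qed
  have tj: "ereal t0 < tj" using beyond t0 ex_t0 .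
  have ex: "ex t" if t: "t0 \<le> t" "ereal t < tj" for t
  proof -
    obtain t' where "t' \<in> I" "ex t'" "t < t'" using t(2) unfolding tj_def less_Sup_iff by auto
    then show ?thesis using ex_antimono[OF I_up[OF t0 t(1)]] by (meson less_imp_le)
  qed
  have "increases_to ev {t \<in> I. ex t} tj \<infinity>"
  proof (rule increases_toI[OF ev_mono _ tj])
    fix M :: real
    show "\<exists>t\<ge>t0. ereal t < tj \<and> M < ev t"
    proof (rule ccontr)
      assume "\<not> ?thesis"
      then have M: "ev t \<le> M" if "t0 \<le> t" "ereal t < tj" for t using that by (auto simp: not_less)
      have "0 < ev t0" using ev_pos t0 ex_t0 by blast
      then have M0: "0 < M" using M[OF order_refl tj] by simp
      then have dom: "dom t M j" if "t0 \<le> t" "ereal t < tj" for t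
        using M[OF that] ev_le_iff[OF I_up[OF t0 that(1)] ex[OF that], of M] by blast
      show False
      proof (cases tj)
        case PInf
        then have "dominated (Ker c) a b M j" using dom by (intro dom_limit_infinity[OF t0 M0]) auto
        then show False
          using not M0 spectral_pair.pos_eigenvalue_exists_iff[OF spectral_pair_Ker j] by blast
      next
        case (real \<tau>)
        then have \<tau>: "t0 < \<tau>" using tj by simp
        have "dom \<tau> M j" using dom real by (intro dom_limit_finite[OF t0 \<tau> M0]) auto
        moreover have \<tau>I: "\<tau> \<in> I" using I_up[OF t0] \<tau> by simp
        ultimately have "ex \<tau>" using ex_iff M0 by blast
        then show False using beyond[OF \<tau>I] real by simp
      next
        case MInf
        then show False using tj by simp
      qed
    qed
  qed (use ex I_up[OF t0] in auto)
  then show ?thesis using tj ex by blast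
qed

end

lemma eigenvalue_asymptotics:
  "\<forall>j::nat. 1 \<le> j \<longrightarrow>
      (let K = Ker c;
           J = num_pos_eigenvalues K a b;
           ex = (\<lambda>t. pos_eigenvalue_exists UNIV a (shifted_form b c t) j);
           ev = (\<lambda>t. pos_eigenvalue UNIV a (shifted_form b c t) j)
       in
         (enat j \<le> J \<longrightarrow>
            (\<forall>t\<in>I. ex t) \<and>
            increases_to ev I \<infinity> (ereal (pos_eigenvalue K a b j))) \<and>
         (\<forall>t0\<in>I. enat j > J \<longrightarrow> ex t0 \<longrightarrow>
            (\<exists>tj::ereal. ereal t0 < tj \<and>
               (\<forall>t. t0 \<le> t \<longrightarrow> ereal t < tj \<longrightarrow> ex t) \<and>
               increases_to ev {t\<in>I. ex t} tj \<infinity>)))"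
  unfolding Let_def
proof (intro allI impI conjI ballI)
  fix j :: nat assume j: "1 \<le> j"
  { assume "enat j \<le> num_pos_eigenvalues (Ker c) a b"
    then have K: "pos_eigenvalue_exists (Ker c) a b j" by (simp add: pos_eigenvalue_exists_def)
    show "pos_eigenvalue_exists UNIV a (shifted_form b c t) j" if "t \<in> I" for t
      using converges_to_Ker_eigenvalue(1)[OF j K] that by blast
    show "increases_to (\<lambda>t. pos_eigenvalue UNIV a (shifted_form b c t) j) I \<infinity>
        (ereal (pos_eigenvalue (Ker c) a b j))"
      by (rule converges_to_Ker_eigenvalue(2)[OF j K]) }
  fix t0 assume "t0 \<in> I" "num_pos_eigenvalues (Ker c) a b < enat j"
    "pos_eigenvalue_exists UNIV a (shifted_form b c t0) j"
  then show "\<exists>tj::ereal. ereal t0 < tj \<and>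
      (\<forall>t. t0 \<le> t \<longrightarrow> ereal t < tj \<longrightarrow> pos_eigenvalue_exists UNIV a (shifted_form b c t) j) \<and>
      increases_to (\<lambda>t. pos_eigenvalue UNIV a (shifted_form b c t) j)
        {t \<in> I. pos_eigenvalue_exists UNIV a (shifted_form b c t) j} tj \<infinity>"
    by (intro diverges[OF j]) (auto simp: pos_eigenvalue_exists_def)
qed

end

section \<open>Fixed and moving Hilbert space conditions\<close>

lemma subspace_Ker: "sym_bilinear f \<Longrightarrow> subspace (Ker f)"
  by (rule subspaceI) (auto simp: Ker_def sym_bilinear_simps)

text \<open>Coercivity makes \<open>Ker a\<close> trivial. Nonnegativity of \<open>a\<close> and the
  continuity facts can then be drawn from the moving conditions in both cases.\<close>

lemma fixed_imp_moving_conditions: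
  fixes a :: "'a::real_inner form"
  assumes a: "sym_bilinear a" and c: "sym_bilinear c" and fixed: "fixed_conditions a b c"
  shows "moving_conditions a b c"
proof -
  obtain \<gamma> where \<gamma>: "\<gamma> > 0" "\<And>u. \<gamma> * (norm u)\<^sup>2 \<le> a u u"
    using fixed by (auto simp: fixed_conditions_def coercive_on_def)
  have "u = 0" if "u \<in> Ker a" for u
  proof -
    have "\<gamma> * (norm u)\<^sup>2 \<le> 0" using \<gamma>(2)[of u] that by (simp add: Ker_def)
    then show ?thesis using \<gamma>(1) by (simp add: mult_le_0_iff)
  qed
  then have Ker_a: "Ker a = {0}" using subspace_0[OF subspace_Ker[OF a]] by auto
  moreover have "0 \<in> Ker c" using subspace_0[OF subspace_Ker[OF c]] .
  moreover have "edim {0::'a} < \<infinity>"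
    unfolding edim_def by (auto intro!: exI[of _ "{}"])
  ultimately show ?thesis
    using fixed by (auto simp: fixed_conditions_def moving_conditions_def coercive_on_def)
qed

text \<open>If the sum were not coercive, unit vectors with \<open>a + c\<close> tending to 0 would
  have a weak limit in \<open>Ker a \<inter> Ker c\<close>, hence 0. Their parts in
  \<open>Ker a\<close> then vanish in the limit by finite dimension, and the complementary parts by
  coercivity of \<open>a\<close>, contradicting norm 1.\<close>

lemma moving_conditions_coercive_sum:
  fixes a :: "'a::{real_inner, complete_space} form"
  assumes a: "sym_bilinear a" and c: "sym_bilinear c" and c_nonneg: "\<And>u. 0 \<le> c u u"
    and moving: "moving_conditions a b c"
  shows "0 \<le> a u u" and "\<exists>\<delta>>0. \<forall>u. \<delta> * (norm u)\<^sup>2 \<le> a u u + c u u"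
proof -
  have a_cont: "jointly_continuous a" and c_cont: "weakly_seq_continuous c"
    and Ker_Int: "Ker a \<inter> Ker c = {0}"
    using moving by (auto simp: moving_conditions_def)
  obtain \<gamma> where \<gamma>: "\<gamma> > 0" "\<And>w. w \<in> orthogonal_comp (Ker a) \<Longrightarrow> \<gamma> * (norm w)\<^sup>2 \<le> a w w"
    using moving by (auto simp: moving_conditions_def coercive_on_def)
  have "edim (Ker a) \<noteq> \<infinity>" using moving by (simp add: moving_conditions_def)
  then obtain B where B: "B \<subseteq> Ker a" "independent B" "finite B" "Ker a \<subseteq> span B" "edim (Ker a) = enat (card B)"
    by (rule edim_basis)
  then have "span B = Ker a" using span_minimal[OF B(1) subspace_Ker[OF a]] by blast
  then obtain j :: nat and e :: "nat \<Rightarrow> 'a" where e_span: "span (e ` {..<j}) = Ker a"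
    and e: "\<forall>i<j. \<forall>k<j. inner (e i) (e k) = (if i = k then 1 else 0)"
    using orthonormal_family[OF B(2,3) refl] by metis
  \<comment> \<open>The orthogonal projection onto \<open>Ker a\<close>; \<open>a\<close> does not
    see this component.\<close>
  define P where "P u = (\<Sum>i<j. inner u (e i) *\<^sub>R e i)" for u
  have P_Ker: "P u \<in> Ker a" for u
    unfolding P_def e_span[symmetric] by (intro span_sum span_scale span_base) auto
  have P_orth: "inner y (u - P u) = 0" if "y \<in> Ker a" for u y
    using that unfolding e_span[symmetric]
  proof (induction rule: span_induct)
    case base
    show ?case by (rule subspaceI) (auto simp: inner_simps)
  next
    case (step y)
    then obtain i where i: "i < j" "y = e i" by auto
    have "inner (e i) (P u) = (\<Sum>k<j. inner u (e k) * inner (e i) (e k))"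
      by (simp add: P_def inner_sum_right)
    also have "\<dots> = (\<Sum>k<j. if k = i then inner u (e k) else 0)"
      using e i(1) by (intro sum.cong refl) auto
    also have "\<dots> = inner u (e i)" using i(1) by simp
    finally show ?case by (simp add: i(2) inner_diff_right inner_commute)
  qed
  then have P_comp: "u - P u \<in> orthogonal_comp (Ker a)" for u
    by (simp add: orthogonal_comp_def orthogonal_def)
  have a_P: "a u u = a (u - P u) (u - P u)" for u
    using P_Ker[of u] sym_bilinear_commute[OF a, of u "P u"]
    by (simp add: sym_bilinear_square_diff[OF a] Ker_def)
  have lower: "\<gamma> * (norm (u - P u))\<^sup>2 \<le> a u u" for u
    unfolding a_P[of u] using \<gamma>(2) P_comp by blast
  show a_nonneg: "0 \<le> a u u" for u
    using lower[of u] \<gamma>(1) by (meson mult_nonneg_nonneg less_imp_le order_trans zero_le_power2)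
  \<comment> \<open>Pythagoras, with the projected part written as a finite sum of weakly continuous
    terms.\<close>
  have norm_P: "(norm u)\<^sup>2 = (\<Sum>i<j. (inner u (e i))\<^sup>2) + (norm (u - P u))\<^sup>2" for u
  proof -
    have "(norm u)\<^sup>2 = (norm (P u))\<^sup>2 + (norm (u - P u))\<^sup>2"
      using P_orth[OF P_Ker, of u u] by (simp add: power2_norm_eq_inner inner_simps inner_commute)
    then show ?thesis using norm_orthonormal_sum[OF e] by (simp add: P_def)
  qed
  show "\<exists>\<delta>>0. \<forall>u. \<delta> * (norm u)\<^sup>2 \<le> a u u + c u u"
  proof (rule ccontr)
    assume not: "\<not> ?thesis"
    have "\<exists>v. norm v = 1 \<and> a v v + c v v \<le> inverse (real (Suc n))" for n
    proof -
      have "0 < inverse (real (Suc n))" by simp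
      then obtain u where u: "a u u + c u u < inverse (real (Suc n)) * (norm u)\<^sup>2"
        using not by (meson not_le)
      then have u0: "u \<noteq> 0" by (auto simp: sym_bilinear_simps[OF a] sym_bilinear_simps[OF c])
      let ?v = "(1 / norm u) *\<^sub>R u"
      have "a ?v ?v + c ?v ?v = (a u u + c u u) / (norm u)\<^sup>2"
        unfolding sym_bilinear_square_scale[OF a] sym_bilinear_square_scale[OF c]
        by (simp add: power_divide add_divide_distrib)
      also have "\<dots> \<le> inverse (real (Suc n))" using u u0 by (simp add: pos_divide_le_eq)
      finally show ?thesis using u0 by (intro exI[of _ ?v]) simp
    qed
    then obtain v where norm_v: "\<And>n. norm (v n) = 1"
      and v: "\<And>n. a (v n) (v n) + c (v n) (v n) \<le> inverse (real (Suc n))" by metis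
    obtain r l where r: "strict_mono r" and l: "weakly_converges (v \<circ> r) l"
      by (rule weak_compactness[of v 1]) (use norm_v in auto)
    have small: "(\<lambda>n. inverse (real (Suc (r n)))) \<longlonglongrightarrow> 0"
      using LIMSEQ_subseq_LIMSEQ[OF LIMSEQ_inverse_real_of_nat r] by (simp add: o_def)
    have a_small: "a (v n) (v n) \<le> inverse (real (Suc n))" for n using v[of n] c_nonneg[of "v n"] by linarith
    have c_small: "c (v n) (v n) \<le> inverse (real (Suc n))" for n using v[of n] a_nonneg[of "v n"] by linarith
    have "a l l \<le> 0"
      using a_small by (intro weak_lower_semicontinuity[OF a a_cont a_nonneg l _ small]) simp
    then have "\<gamma> * (norm (l - P l))\<^sup>2 \<le> 0" using lower[of l] by simp
    then have "l = P l" using \<gamma>(1) by (simp add: mult_le_0_iff)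
    then have "l \<in> Ker a" using P_Ker[of l] by simp
    moreover have "l \<in> Ker c"
    proof -
      have "(\<lambda>n. c ((v \<circ> r) n) ((v \<circ> r) n)) \<longlonglongrightarrow> c l l"
        using c_cont l unfolding weakly_seq_continuous_def by blast
      then have "c l l \<le> 0" by (rule LIMSEQ_le[OF _ small]) (use c_small in auto)
      then have "c l l = 0" using c_nonneg[of l] by simp
      then show ?thesis
        using semidefinite_null_vector[OF c subspace_UNIV c_nonneg UNIV_I] by (auto simp: Ker_def)
    qed
    ultimately have l0: "l = 0" using Ker_Int by blast
    have "(\<lambda>n. (\<Sum>i<j. (inner (v (r n)) (e i))\<^sup>2)) \<longlonglongrightarrow> (\<Sum>i<j. (inner l (e i))\<^sup>2)"
      using l by (intro tendsto_sum tendsto_power) (simp add: weakly_converges_def)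
    moreover have "(\<lambda>n. (norm (v (r n) - P (v (r n))))\<^sup>2) \<longlonglongrightarrow> 0"
    proof (rule tendsto_sandwich[of "\<lambda>_. 0"])
      show "(\<lambda>n. inverse (real (Suc (r n))) / \<gamma>) \<longlonglongrightarrow> 0"
        using tendsto_divide[OF small tendsto_const, of \<gamma>] \<gamma>(1) by simp
      have "(norm (v n - P (v n)))\<^sup>2 \<le> inverse (real (Suc n)) / \<gamma>" for n
        using lower[of "v n"] a_small[of n] \<gamma>(1) by (simp add: pos_le_divide_eq mult.commute)
      then show "\<forall>\<^sub>F n in sequentially. (norm (v (r n) - P (v (r n))))\<^sup>2 \<le> inverse (real (Suc (r n))) / \<gamma>"
        by simp
    qed simp_all
    ultimately have "(\<lambda>n. (norm (v (r n)))\<^sup>2) \<longlonglongrightarrow> (\<Sum>i<j. (inner l (e i))\<^sup>2) + 0"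
      unfolding norm_P[of "v _"] by (rule tendsto_add)
    then show False by (simp add: norm_v l0 LIMSEQ_const_iff)
  qed
qed

text \<open>\<open>I\<close> is chosen before \<open>j\<close>, so the threshold in the moving case
  depends on the forms only. The two cases differ in \<open>I\<close> and in the source of
  coercivity of the shifted form.\<close>

theorem theorem2p3:
  fixes a b c :: "'a::{real_inner, complete_space} \<Rightarrow> 'a \<Rightarrow> real"
  assumes "sym_bilinear a" and "sym_bilinear b" and "sym_bilinear c"
    and "\<forall>u. c u u \<ge> 0" and "\<exists>u. c u u \<noteq> 0"
    and "fixed_conditions a b c \<or> moving_conditions a b c"
  shows "\<exists>I :: real set.
    (if fixed_conditions a b c then I = UNIV else \<exists>T. I = {T..}) \<and>
    (\<forall>j::nat. 1 \<le> j \<longrightarrow>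
      (let K = Ker c;
           J = num_pos_eigenvalues K a b;
           ex = (\<lambda>t. pos_eigenvalue_exists UNIV a (shifted_form b c t) j);
           ev = (\<lambda>t. pos_eigenvalue UNIV a (shifted_form b c t) j)
       in
         (enat j \<le> J \<longrightarrow>
            (\<forall>t\<in>I. ex t) \<and>
            increases_to ev I \<infinity> (ereal (pos_eigenvalue K a b j))) \<and>
         (\<forall>t0\<in>I. enat j > J \<longrightarrow> ex t0 \<longrightarrow>
            (\<exists>tj::ereal. ereal t0 < tj \<and>
               (\<forall>t. t0 \<le> t \<longrightarrow> ereal t < tj \<longrightarrow> ex t) \<and>
               increases_to ev {t\<in>I. ex t} tj \<infinity>))))"
proof -
  note a = assms(1) and b = assms(2) and c = assms(3)
  have c_nonneg: "\<And>u. 0 \<le> c u u" using assms(4) by blast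
  have moving: "moving_conditions a b c" using assms(6) fixed_imp_moving_conditions[OF a c] by blast
  then have cont: "jointly_continuous a" "weakly_seq_continuous b" "weakly_seq_continuous c"
    by (auto simp: moving_conditions_def)
  note a_nonneg = moving_conditions_coercive_sum(1)[OF a c c_nonneg moving]
  have "\<exists>I. (if fixed_conditions a b c then I = UNIV else \<exists>T. I = {T..}) \<and>
    (\<forall>t\<in>I. \<exists>s>0. coercive_on UNIV (shifted_form a (shifted_form b c t) s))"
  proof (cases "fixed_conditions a b c")
    case True
    obtain \<gamma> where \<gamma>: "\<gamma> > 0" "\<And>u. \<gamma> * (norm u)\<^sup>2 \<le> a u u"
      using True by (auto simp: fixed_conditions_def coercive_on_def)
    have "\<exists>s>0. coercive_on UNIV (shifted_form a (shifted_form b c t) s)" for t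
    proof -
      obtain \<beta> where \<beta>: "\<beta> > 0" "\<And>u. \<bar>shifted_form b c t u u\<bar> \<le> \<beta> * (norm u)\<^sup>2"
        using weakly_seq_continuous_bounded[OF sym_bilinear_shifted_form[OF b c]
            weakly_seq_continuous_shifted_form[OF cont(2,3)]] by blast
      \<comment> \<open>Small enough that \<open>s\<close> times the shifted form takes at most half
        of the coercivity constant.\<close>
      define s where "s = \<gamma> / (2 * \<beta>)"
      have s: "s > 0" using \<gamma>(1) \<beta>(1) by (simp add: s_def)
      have "(\<gamma> / 2) * (norm u)\<^sup>2 \<le> shifted_form a (shifted_form b c t) s u u" for u
      proof -
        have "s * shifted_form b c t u u \<le> s * (\<beta> * (norm u)\<^sup>2)"
          using s \<beta>(2)[of u] by (intro mult_left_mono) auto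
        also have "\<dots> = (\<gamma> / 2) * (norm u)\<^sup>2" using \<beta>(1) by (simp add: s_def)
        finally show ?thesis using \<gamma>(2)[of u] unfolding shifted_form_def[of a] by linarith
      qed
      then have "coercive_on UNIV (shifted_form a (shifted_form b c t) s)"
        unfolding coercive_on_def using \<gamma>(1) by (intro exI[of _ "\<gamma> / 2"]) simp
      then show ?thesis using s by blast
    qed
    then show ?thesis using True by auto
  next
    case False
    obtain \<delta> where \<delta>: "\<delta> > 0" "\<And>u. \<delta> * (norm u)\<^sup>2 \<le> a u u + c u u"
      using moving_conditions_coercive_sum(2)[OF a c c_nonneg moving] by blast
    obtain \<beta> where \<beta>: "\<beta> > 0" "\<And>u. \<bar>b u u\<bar> \<le> \<beta> * (norm u)\<^sup>2"
      using weakly_seq_continuous_bounded[OF b cont(2)] by blast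
    have "\<exists>s>0. coercive_on UNIV (shifted_form a (shifted_form b c t) s)"
      if t: "2 * \<beta> / \<delta> \<le> t" for t
    proof -
      have "0 < 2 * \<beta> / \<delta>" using \<beta>(1) \<delta>(1) by simp
      then have t0: "t > 0" using t by linarith
      \<comment> \<open>With \<open>s = 1 / t\<close> the shifted form is
        \<open>a + c - b / t\<close>; from this threshold on, \<open>b / t\<close> takes at most
        half of the coercivity of \<open>a + c\<close>.\<close>
      have \<beta>t: "\<beta> / t \<le> \<delta> / 2" using t t0 \<delta>(1) by (simp add: field_simps)
      have "(\<delta> / 2) * (norm u)\<^sup>2 \<le> shifted_form a (shifted_form b c t) (1 / t) u u" for u
      proof -
        have "b u u / t \<le> (\<beta> * (norm u)\<^sup>2) / t"
          using \<beta>(2)[of u] t0 by (intro divide_right_mono) auto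
        also have "\<dots> \<le> (\<delta> / 2) * (norm u)\<^sup>2"
          using mult_right_mono[OF \<beta>t, of "(norm u)\<^sup>2"] by simp
        finally have "b u u / t \<le> (\<delta> / 2) * (norm u)\<^sup>2" .
        moreover have "shifted_form a (shifted_form b c t) (1 / t) u u = a u u + c u u - b u u / t"
          using t0 by (simp add: shifted_form_def field_simps)
        ultimately show ?thesis using \<delta>(2)[of u] by linarith
      qed
      then have "coercive_on UNIV (shifted_form a (shifted_form b c t) (1 / t))"
        unfolding coercive_on_def using \<delta>(1) by (intro exI[of _ "\<delta> / 2"]) simp
      then show ?thesis using t0 by (intro exI[of _ "1 / t"]) simp
    qed
    then show ?thesis using False by (intro exI[of _ "{2 * \<beta> / \<delta>..}"]) auto
  qed
  then obtain I where I: "if fixed_conditions a b c then I = UNIV else \<exists>T. I = {T..}"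
    and co: "\<And>t. t \<in> I \<Longrightarrow> \<exists>s>0. coercive_on UNIV (shifted_form a (shifted_form b c t) s)"
    by blast
  have "spectral_family a b c I"
    by unfold_locales (use a b c cont a_nonneg c_nonneg I co in \<open>auto split: if_splits\<close>)
  then show ?thesis using I spectral_family.eigenvalue_asymptotics by blast
qed

end
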